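(* For all finite dimensions $d_{A_1},d_{A_2}$, the non-local texture $\mathcal{T}_{NL}^{A_1:A_2}$ is a valid entanglement monotone on the bipartite density matrices $\rho_{A_1A_2}$ on $\mathbb{C}^{d_{A_1}}\otimes\mathbb{C}^{d_{A_2}}$, that is: (1) $\mathcal{T}_{NL}^{A_1:A_2}(\rho_{A_1A_2})\ge 0$, with equality if and only if $\rho_{A_1A_2}$ is separable; (2) $\mathcal{T}_{NL}^{A_1:A_2}(\Lambda(\rho_{A_1A_2}))\le\mathcal{T}_{NL}^{A_1:A_2}(\rho_{A_1A_2})$ for every density matrix $\rho_{A_1A_2}$ and every LOCC (local operations and classical communication) channel $\Lambda$ on $\mathbb{C}^{d_{A_1}}\otimes\mathbb{C}^{d_{A_2}}$.
   Context: For an orthonormal basis $\mathsf{B}=\{|i\rangle\}_{i=1}^d$ of a $d$-dimensional Hilbert space and a pure state $|\Psi\rangle$ in it, the texture of $|\Psi\rangle$ with respect to $\mathsf{B}$ is $$\mathcal{T}_{\mathsf{B}}(|\Psi\rangle)=1-\frac1d\sum_{i,j=1}^d\langle i|\Psi\rangle\langle\Psi|j\rangle=1-|\langle s_1|\Psi\rangle|^2,\qquad |s_1\rangle=\frac1{\sqrt d}\sum_{i=1}^d|i\rangle .$$ For orthonormal bases $\mathsf{B}_{A_1}$ of $\mathbb{C}^{d_{A_1}}$ and $\mathsf{B}_{A_2}$ of $\mathbb{C}^{d_{A_2}}$, $\mathsf{B}_{A_1}\otimes\mathsf{B}_{A_2}$ denotes the product basis of $\mathbb{C}^{d_{A_1}}\otimes\mathbb{C}^{d_{A_2}}$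 formed by all tensor products of their elements. The non-local texture of a density matrix $\rho_{A_1A_2}$ on $\mathbb{C}^{d_{A_1}}\otimes\mathbb{C}^{d_{A_2}}$ is $$\mathcal{T}_{NL}^{A_1:A_2}(\rho_{A_1A_2})=\min_{\{p_i,|\Psi_i\rangle\}}\ \sum_i p_i\ \min_{\mathsf{B}_{A_1},\mathsf{B}_{A_2}}\mathcal{T}_{\mathsf{B}_{A_1}\otimes\mathsf{B}_{A_2}}(|\Psi_i\rangle),$$ where the outer minimum is over all finite pure-state decompositions $\rho_{A_1A_2}=\sum_i p_i|\Psi_i\rangle\langle\Psi_i|$ (with $(p_i)$ a probability distribution and $|\Psi_i\rangle$ unit vectors), and the inner minimum is over all orthonormal bases $\mathsf{B}_{A_1}$, $\mathsf{B}_{A_2}$ of the two factors. A density matrix is separable if it is a convex combination of pure product states $|a\rangle\langle a|\otimes|b\rangle\langle b|$. *)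

theory Defs
  imports Complex_Main "Jordan_Normal_Form.Matrix" "Jordan_Normal_Form.Schur_Decomposition"
begin

(* The space C^m (x) C^n is identified with C^(m * n), the index pair (i, k) being
   i * n + k.  The library's v \<bullet>c w conjugates w, so <v|w> is w \<bullet>c v. *)

definition tensor_vec :: "complex vec \<Rightarrow> complex vec \<Rightarrow> complex vec" where
  "tensor_vec v w = vec (dim_vec v * dim_vec w)
     (\<lambda>i. v $ (i div dim_vec w) * w $ (i mod dim_vec w))"

definition tensor_mat :: "complex mat \<Rightarrow> complex mat \<Rightarrow> complex mat" where
  "tensor_mat A B = mat (dim_row A * dim_row B) (dim_col A * dim_col B)
     (\<lambda>(i, j). A $$ (i div dim_row B, j div dim_col B) * B $$ (i mod dim_row B, j mod dim_col B))"

definition ketbra :: "complex vec \<Rightarrow> complex mat" where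
  "ketbra v = mat (dim_vec v) (dim_vec v) (\<lambda>(i, j). v $ i * cnj (v $ j))"

definition mat_sum :: "nat \<Rightarrow> nat \<Rightarrow> complex mat list \<Rightarrow> complex mat" where
  "mat_sum nr nc Ms = foldr (+) Ms (0\<^sub>m nr nc)"

definition pure_state :: "nat \<Rightarrow> complex vec \<Rightarrow> bool" where
  "pure_state n v \<longleftrightarrow> v \<in> carrier_vec n \<and> v \<bullet>c v = 1"

(* With the library's order on complex numbers, 0 \<le> z says that z is real and
   nonnegative; the quadratic form condition therefore includes hermiticity. *)
definition density_mat :: "nat \<Rightarrow> complex mat \<Rightarrow> bool" where
  "density_mat n \<rho> \<longleftrightarrow> \<rho> \<in> carrier_mat n n \<and>
     (\<forall>v \<in> carrier_vec n. 0 \<le> (\<rho> *\<^sub>v v) \<bullet>c v) \<and>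
     (\<Sum>i<n. \<rho> $$ (i, i)) = 1"

definition orthonormal_basis :: "nat \<Rightarrow> complex vec list \<Rightarrow> bool" where
  "orthonormal_basis n bs \<longleftrightarrow> length bs = n \<and> set bs \<subseteq> carrier_vec n \<and>
     (\<forall>i<n. \<forall>j<n. bs ! i \<bullet>c bs ! j = (if i = j then 1 else 0))"

definition product_basis :: "complex vec list \<Rightarrow> complex vec list \<Rightarrow> complex vec list" where
  "product_basis as bs = [tensor_vec a b. a \<leftarrow> as, b \<leftarrow> bs]"

(* The double sum is the real number |\<Sum>i. <i|\<psi>>|^2, so Re discards nothing. *)
definition texture :: "complex vec list \<Rightarrow> complex vec \<Rightarrow> real" where
  "texture bs \<psi> = 1 - Re (\<Sum>i<length bs. \<Sum>j<length bs. (\<psi> \<bullet>c bs ! i) * (bs ! j \<bullet>c \<psi>))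
                      / real (length bs)"

(* In this and the next infimum the index set is nonempty for the arguments of
   interest, the values are nonnegative, and a minimum exists by compactness. *)
definition pure_nonlocal_texture :: "nat \<Rightarrow> nat \<Rightarrow> complex vec \<Rightarrow> real" where
  "pure_nonlocal_texture dA dB \<psi> =
     (INF (as, bs) \<in> {as. orthonormal_basis dA as} \<times> {bs. orthonormal_basis dB bs}.
        texture (product_basis as bs) \<psi>)"

definition pure_decomposition :: "nat \<Rightarrow> complex mat \<Rightarrow> (real \<times> complex vec) list \<Rightarrow> bool" where
  "pure_decomposition n \<rho> E \<longleftrightarrow>
     (\<forall>(p, \<psi>) \<in> set E. 0 \<le> p \<and> pure_state n \<psi>) \<and> (\<Sum>(p, \<psi>)\<leftarrow>E. p) = 1 \<and>
     \<rho> = mat_sum n n [complex_of_real p \<cdot>\<^sub>m ketbra \<psi>. (p, \<psi>) \<leftarrow> E]"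

definition nonlocal_texture :: "nat \<Rightarrow> nat \<Rightarrow> complex mat \<Rightarrow> real" where
  "nonlocal_texture dA dB \<rho> =
     (INF E \<in> {E. pure_decomposition (dA * dB) \<rho> E}.
        \<Sum>(p, \<psi>)\<leftarrow>E. p * pure_nonlocal_texture dA dB \<psi>)"

definition separable_state :: "nat \<Rightarrow> nat \<Rightarrow> complex mat \<Rightarrow> bool" where
  "separable_state dA dB \<rho> \<longleftrightarrow> (\<exists>E :: (real \<times> complex vec \<times> complex vec) list.
     (\<forall>(p, a, b) \<in> set E. 0 \<le> p \<and> pure_state dA a \<and> pure_state dB b) \<and>
     (\<Sum>(p, a, b)\<leftarrow>E. p) = 1 \<and>
     \<rho> = mat_sum (dA * dB) (dA * dB)
           [complex_of_real p \<cdot>\<^sub>m tensor_mat (ketbra a) (ketbra b). (p, a, b) \<leftarrow> E])"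

(* Completely positive maps are given by lists of Kraus operators; m is the
   output dimension, n the input dimension. *)
definition kraus_map :: "nat \<Rightarrow> complex mat list \<Rightarrow> complex mat \<Rightarrow> complex mat" where
  "kraus_map m Ks X = mat_sum m m [K * X * mat_adjoint K. K \<leftarrow> Ks]"

definition trace_preserving :: "nat \<Rightarrow> complex mat list \<Rightarrow> bool" where
  "trace_preserving n Ks \<longleftrightarrow> mat_sum n n [mat_adjoint K * K. K \<leftarrow> Ks] = 1\<^sub>m n"

(* One-way LOCC channel \<Lambda> = \<Sum>k. \<Phi> k (x) \<Psi> k from C^nA (x) C^nB to C^mA (x) C^mB:
   the sender A applies the quantum instrument (\<Phi> k) and announces the outcome k,
   upon which B applies the channel \<Psi> k.  The k-th entry of the list ops consists of
   Kraus operators of \<Phi> k and of \<Psi> k; no single \<Phi> k need be trace preserving. *)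
definition one_way_AB ::
  "nat \<Rightarrow> nat \<Rightarrow> nat \<Rightarrow> nat \<Rightarrow> (complex mat \<Rightarrow> complex mat) \<Rightarrow> bool" where
  "one_way_AB nA nB mA mB \<Lambda> \<longleftrightarrow> (\<exists>ops :: (complex mat list \<times> complex mat list) list.
     (\<forall>(As, Bs) \<in> set ops. set As \<subseteq> carrier_mat mA nA \<and> set Bs \<subseteq> carrier_mat mB nB \<and>
        trace_preserving nB Bs) \<and>
     trace_preserving nA (concat (map fst ops)) \<and>
     (\<forall>X \<in> carrier_mat (nA * nB) (nA * nB). \<Lambda> X =
        kraus_map (mA * mB) [tensor_mat A B. (As, Bs) \<leftarrow> ops, A \<leftarrow> As, B \<leftarrow> Bs] X))"

definition one_way_BA ::
  "nat \<Rightarrow> nat \<Rightarrow> nat \<Rightarrow> nat \<Rightarrow> (complex mat \<Rightarrow> complex mat) \<Rightarrow> bool" where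
  "one_way_BA nA nB mA mB \<Lambda> \<longleftrightarrow> (\<exists>ops :: (complex mat list \<times> complex mat list) list.
     (\<forall>(As, Bs) \<in> set ops. set As \<subseteq> carrier_mat mA nA \<and> set Bs \<subseteq> carrier_mat mB nB \<and>
        trace_preserving nA As) \<and>
     trace_preserving nB (concat (map snd ops)) \<and>
     (\<forall>X \<in> carrier_mat (nA * nB) (nA * nB). \<Lambda> X =
        kraus_map (mA * mB) [tensor_mat A B. (As, Bs) \<leftarrow> ops, A \<leftarrow> As, B \<leftarrow> Bs] X))"

(* LOCC channels are the finite compositions of one-way LOCC channels in either
   direction.  The intermediate local dimensions are unrestricted, so that the
   parties may use ancillas and remember the outcomes of earlier rounds. *)
inductive locc :: "nat \<Rightarrow> nat \<Rightarrow> nat \<Rightarrow> nat \<Rightarrow> (complex mat \<Rightarrow> complex mat) \<Rightarrow> bool" where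
  AB: "one_way_AB nA nB mA mB \<Lambda> \<Longrightarrow> locc nA nB mA mB \<Lambda>"
| BA: "one_way_BA nA nB mA mB \<Lambda> \<Longrightarrow> locc nA nB mA mB \<Lambda>"
| comp: "locc nA nB kA kB \<Lambda> \<Longrightarrow> locc kA kB mA mB \<Gamma> \<Longrightarrow> locc nA nB mA mB (\<Gamma> \<circ> \<Lambda>)"

end

(* The inner minimum over product bases equals 1 - mu, where mu is the squared operator norm of the
   coefficient matrix M of the vector: the normalized sum of an orthonormal basis can be any unit
   vector up to a phase, so the minimum picks the best product vector.  A complete measurement (A_k)
   of one party maps M to the matrices A_k M, and sum |A_k M y|^2 = |M y|^2 shows that mu, extended
   homogeneously to unnormalized vectors, does not decrease on average.  Pushing a decomposition
   through one-way protocols thus never increases its cost.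

   If the infimum is 0, replacing vectors by nearby product vectors exhibits the state as a limit of
   separable states.  By Caratheodory's theorem these can be written with a bounded number of
   terms, so a limit of convergent subsequences is a product decomposition of the state itself. *)

theory Submission
  imports Defs "HOL-Analysis.L2_Norm"
begin

subsection \<open>Operator norm of the coefficient matrix\<close>

text \<open>Ensembles are handled as lists of unnormalized vectors \<phi> = sqrt p \<psi>. A Kraus
  operator K turns \<phi> into the next vector K \<phi> without division by the probability of the
  outcome, and outcomes of probability zero become zero vectors of cost zero. This agrees with the
  weighted average because the cost, squared norm minus mu, is homogeneous of degree two. Infima
  replace minima up to the last step; compactness enters only where a limit of separable states is
  shown to be separable. An infimum over decompositions can be bounded from below only if some
  decomposition exists, and a Cholesky factorization of the density matrix supplies one. LOCC
  protocols may change the local dimensions from round to round. Since mu is a supremum over unit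
  vectors, which do not exist in dimension zero, positivity of the dimensions is carried along with
  the decompositions.\<close>

definition norm_sq :: "complex vec \<Rightarrow> real" where
  "norm_sq v = (\<Sum>i<dim_vec v. (cmod (v $ i))\<^sup>2)"

definition frob_sq :: "complex mat \<Rightarrow> real" where
  "frob_sq M = (\<Sum>i<dim_row M. \<Sum>j<dim_col M. (cmod (M $$ (i, j)))\<^sup>2)"

text \<open>This is the squared operator norm. Testing with a vector on each side treats rows and
  columns alike and makes every value a squared overlap with a product vector. In dimension 0 the
  index set is empty.\<close>

definition max_overlap :: "complex mat \<Rightarrow> real" where
  "max_overlap M = (SUP (x, y) \<in> {x. pure_state (dim_row M) x} \<times> {y. pure_state (dim_col M) y}.
     (cmod ((M *\<^sub>v y) \<bullet>c x))\<^sup>2)"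

section \<open>Sums, norms and trace preservation\<close>

lemma sum_prod_index:
  fixes f :: "nat \<Rightarrow> 'a::comm_monoid_add"
  shows "(\<Sum>k<m * n. f k) = (\<Sum>i<m. \<Sum>j<n. f (i * n + j))"
proof -
  have "(\<Sum>k<m * n. f k) = (\<Sum>i<m. sum f {i * n..<i * n + n})"
    by (rule sum.nat_group [symmetric])
  also have "\<dots> = (\<Sum>i<m. \<Sum>j<n. f (i * n + j))"
    by (simp add: sum.atLeastLessThan_shift_0 [of _ "_ * n"] lessThan_atLeast0)
  finally show ?thesis .
qed

lemma sum_list_sum_swap:
  fixes f :: "'a \<Rightarrow> 'b \<Rightarrow> 'c::comm_monoid_add"
  shows "(\<Sum>x\<leftarrow>xs. \<Sum>i\<in>A. f x i) = (\<Sum>i\<in>A. \<Sum>x\<leftarrow>xs. f x i)"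
  by (induction xs) (simp_all add: sum.distrib)

lemma sum_list_swap:
  fixes f :: "'a \<Rightarrow> 'b \<Rightarrow> 'c::comm_monoid_add"
  shows "(\<Sum>x\<leftarrow>xs. \<Sum>y\<leftarrow>ys. f x y) = (\<Sum>y\<leftarrow>ys. \<Sum>x\<leftarrow>xs. f x y)"
  by (induction xs) (simp_all add: sum_list_addf)

lemma sum_list_map_concat:
  "sum_list (map f (concat xss)) = (\<Sum>xs\<leftarrow>xss. sum_list (map f xs))"
  by (induction xss) simp_all

lemma cscalar_sum:
  fixes v w :: "complex vec"
  shows "w \<in> carrier_vec n \<Longrightarrow> v \<bullet>c w = (\<Sum>i<n. v $ i * cnj (w $ i))"
  by (simp add: scalar_prod_def lessThan_atLeast0)

lemma cscalar_self: "v \<bullet>c v = complex_of_real (norm_sq v)"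
  by (simp add: cscalar_sum [of v "dim_vec v"] norm_sq_def complex_norm_square [symmetric] del: of_real_power)

lemma pure_state_iff: "pure_state n v \<longleftrightarrow> v \<in> carrier_vec n \<and> norm_sq v = 1"
  unfolding pure_state_def cscalar_self by simp

lemma norm_sq_nonneg [simp]: "0 \<le> norm_sq v"
  by (simp add: norm_sq_def sum_nonneg)

lemma frob_sq_nonneg [simp]: "0 \<le> frob_sq M"
  by (simp add: frob_sq_def sum_nonneg)

lemma norm_sq_smult: "norm_sq (c \<cdot>\<^sub>v v) = (cmod c)\<^sup>2 * norm_sq v"
  by (simp add: norm_sq_def norm_mult power_mult_distrib sum_distrib_left)

lemma norm_sq_conjugate: "norm_sq (conjugate v) = norm_sq v"
  by (simp add: norm_sq_def)

lemma pure_state_conjugate: "pure_state n v \<Longrightarrow> pure_state n (conjugate v)"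
  by (simp add: pure_state_iff norm_sq_conjugate)

lemma pure_state_exists:
  assumes "0 < n"
  obtains v where "pure_state n v"
proof
  show "pure_state n (unit_vec n 0)"
    unfolding pure_state_iff norm_sq_def using assms
    by (simp add: unit_vec_def if_distrib [of cmod] if_distrib [of "\<lambda>x. x\<^sup>2"] cong: if_cong)
qed

lemma normalize_pure_state:
  assumes "v \<in> carrier_vec n" "norm_sq v \<noteq> 0"
  shows "pure_state n (complex_of_real (1 / sqrt (norm_sq v)) \<cdot>\<^sub>v v)"
  using assms by (simp add: pure_state_iff norm_sq_smult norm_divide power_divide)

lemma norm_sum_mult_le:
  fixes f g :: "'a \<Rightarrow> complex"
  shows "(cmod (\<Sum>i\<in>A. f i * g i))\<^sup>2 \<le> (\<Sum>i\<in>A. (cmod (f i))\<^sup>2) * (\<Sum>i\<in>A. (cmod (g i))\<^sup>2)"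
proof -
  have "cmod (\<Sum>i\<in>A. f i * g i) \<le> (\<Sum>i\<in>A. \<bar>cmod (f i)\<bar> * \<bar>cmod (g i)\<bar>)"
    by (rule sum_norm_le) (simp add: norm_mult)
  also have "\<dots> \<le> L2_set (\<lambda>i. cmod (f i)) A * L2_set (\<lambda>i. cmod (g i)) A"
    by (rule L2_set_mult_ineq)
  finally have "(cmod (\<Sum>i\<in>A. f i * g i))\<^sup>2 \<le> (L2_set (\<lambda>i. cmod (f i)) A * L2_set (\<lambda>i. cmod (g i)) A)\<^sup>2"
    by (rule power_mono) simp
  then show ?thesis
    by (simp add: L2_set_def power_mult_distrib sum_nonneg)
qed

lemma cauchy_schwarz:
  assumes "v \<in> carrier_vec n" "w \<in> carrier_vec n"
  shows "(cmod (v \<bullet>c w))\<^sup>2 \<le> norm_sq v * norm_sq w"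
  using norm_sum_mult_le [of "\<lambda>i. v $ i" "\<lambda>i. cnj (w $ i)" "{..<n}"] assms
  by (simp add: cscalar_sum norm_sq_def)

lemma norm_sq_mult_mat_vec_le:
  assumes "M \<in> carrier_mat m n" "v \<in> carrier_vec n"
  shows "norm_sq (M *\<^sub>v v) \<le> frob_sq M * norm_sq v"
proof -
  have "norm_sq (M *\<^sub>v v) = (\<Sum>i<m. (cmod (\<Sum>j<n. M $$ (i, j) * v $ j))\<^sup>2)"
    using assms by (simp add: norm_sq_def scalar_prod_def lessThan_atLeast0)
  also have "\<dots> \<le> (\<Sum>i<m. (\<Sum>j<n. (cmod (M $$ (i, j)))\<^sup>2) * (\<Sum>j<n. (cmod (v $ j))\<^sup>2))"
    by (intro sum_mono norm_sum_mult_le)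
  also have "\<dots> = frob_sq M * norm_sq v"
    using assms by (simp add: frob_sq_def norm_sq_def sum_distrib_right)
  finally show ?thesis .
qed

lemma mat_sum_carrier: "set Ms \<subseteq> carrier_mat r c \<Longrightarrow> mat_sum r c Ms \<in> carrier_mat r c"
  unfolding mat_sum_def by (induction Ms) auto

lemma mat_sum_index:
  "set Ms \<subseteq> carrier_mat r c \<Longrightarrow> i < r \<Longrightarrow> j < c \<Longrightarrow>
     mat_sum r c Ms $$ (i, j) = (\<Sum>M\<leftarrow>Ms. M $$ (i, j))"
proof (induction Ms)
  case (Cons M Ms)
  then have "mat_sum r c Ms \<in> carrier_mat r c"
    by (intro mat_sum_carrier) auto
  with Cons show ?case by (auto simp: mat_sum_def)
qed (simp add: mat_sum_def)

lemma mat_adjoint_carrier: "A \<in> carrier_mat m n \<Longrightarrow> mat_adjoint A \<in> carrier_mat n m"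
  unfolding mat_adjoint_def by (intro carrier_matI) simp_all

lemma mat_adjoint_index:
  "A \<in> carrier_mat m n \<Longrightarrow> i < n \<Longrightarrow> j < m \<Longrightarrow> mat_adjoint A $$ (i, j) = cnj (A $$ (j, i))"
  unfolding mat_adjoint_def by (simp add: mat_of_rows_index)

lemma mult_mat_vec_sum:
  "M \<in> carrier_mat m n \<Longrightarrow> v \<in> carrier_vec n \<Longrightarrow> i < m \<Longrightarrow>
    (M *\<^sub>v v) $ i = (\<Sum>j<n. M $$ (i, j) * v $ j)"
  by (simp add: scalar_prod_def lessThan_atLeast0)

lemma trace_preserving_entries:
  assumes "set Ks \<subseteq> carrier_mat m n" "trace_preserving n Ks" "i < n" "j < n"
  shows "(\<Sum>K\<leftarrow>Ks. \<Sum>k<m. cnj (K $$ (k, i)) * K $$ (k, j)) = (if i = j then 1 else 0)"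
proof -
  have c: "set [mat_adjoint K * K. K \<leftarrow> Ks] \<subseteq> carrier_mat n n"
  proof -
    have "mat_adjoint K * K \<in> carrier_mat n n" if "K \<in> set Ks" for K
      using that assms(1) by (intro mult_carrier_mat [of _ n m] mat_adjoint_carrier) auto
    then show ?thesis by auto
  qed
  have "(\<Sum>K\<leftarrow>Ks. \<Sum>k<m. cnj (K $$ (k, i)) * K $$ (k, j)) = (\<Sum>K\<leftarrow>Ks. (mat_adjoint K * K) $$ (i, j))"
  proof (intro arg_cong [of _ _ sum_list] map_cong refl)
    fix K assume "K \<in> set Ks"
    then have K: "K \<in> carrier_mat m n" using assms(1) by auto
    from K mat_adjoint_carrier [OF K] assms(3,4)
    show "(\<Sum>k<m. cnj (K $$ (k, i)) * K $$ (k, j)) = (mat_adjoint K * K) $$ (i, j)"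
      by (simp add: scalar_prod_def lessThan_atLeast0 mat_adjoint_index)
  qed
  also have "\<dots> = mat_sum n n [mat_adjoint K * K. K \<leftarrow> Ks] $$ (i, j)"
    using mat_sum_index [OF c assms(3,4)] by (simp add: o_def)
  also have "\<dots> = (if i = j then 1 else 0)"
    using assms by (simp add: trace_preserving_def)
  finally show ?thesis .
qed

text \<open>The probabilities of the outcomes add up: each term is the quadratic form of K^* K at v,
  and these matrices sum to the identity.\<close>

lemma sum_norm_sq_trace_preserving:
  assumes Ks: "set Ks \<subseteq> carrier_mat m n" and tp: "trace_preserving n Ks" and v: "v \<in> carrier_vec n"
  shows "(\<Sum>K\<leftarrow>Ks. norm_sq (K *\<^sub>v v)) = norm_sq v"
proof -
  have K: "complex_of_real (norm_sq (K *\<^sub>v v)) =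
      (\<Sum>i<n. \<Sum>j<n. cnj (v $ i) * v $ j * (\<Sum>k<m. cnj (K $$ (k, i)) * K $$ (k, j)))"
    if "K \<in> set Ks" for K
  proof -
    have K: "K \<in> carrier_mat m n" using that Ks by auto
    have "complex_of_real (norm_sq (K *\<^sub>v v)) = (\<Sum>k<m. (K *\<^sub>v v) $ k * cnj ((K *\<^sub>v v) $ k))"
      unfolding cscalar_self [symmetric] using K v by (intro cscalar_sum) auto
    also have "\<dots> = (\<Sum>k<m. (\<Sum>j<n. K $$ (k, j) * v $ j) * cnj (\<Sum>i<n. K $$ (k, i) * v $ i))"
      by (intro sum.cong refl) (simp add: mult_mat_vec_sum [OF K v] del: index_mult_mat_vec)
    also have "\<dots> = (\<Sum>k<m. \<Sum>i<n. \<Sum>j<n. cnj (v $ i) * v $ j * (cnj (K $$ (k, i)) * K $$ (k, j)))"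
      unfolding cnj_sum sum_product
      by (subst sum.swap) (simp add: mult_ac)
    also have "\<dots> = (\<Sum>i<n. \<Sum>k<m. \<Sum>j<n. cnj (v $ i) * v $ j * (cnj (K $$ (k, i)) * K $$ (k, j)))"
      by (rule sum.swap)
    also have "\<dots> = (\<Sum>i<n. \<Sum>j<n. \<Sum>k<m. cnj (v $ i) * v $ j * (cnj (K $$ (k, i)) * K $$ (k, j)))"
      by (intro sum.cong refl sum.swap)
    finally show ?thesis by (simp add: sum_distrib_left)
  qed
  have "complex_of_real (\<Sum>K\<leftarrow>Ks. norm_sq (K *\<^sub>v v)) = (\<Sum>K\<leftarrow>Ks. complex_of_real (norm_sq (K *\<^sub>v v)))"
    by (induction Ks) simp_all
  also have "\<dots> = (\<Sum>K\<leftarrow>Ks. \<Sum>i<n. \<Sum>j<n. cnj (v $ i) * v $ j * (\<Sum>k<m. cnj (K $$ (k, i)) * K $$ (k, j)))"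
    using K by (intro arg_cong [of _ _ sum_list] map_cong refl) auto
  also have "\<dots> = (\<Sum>i<n. \<Sum>j<n. cnj (v $ i) * v $ j * (\<Sum>K\<leftarrow>Ks. \<Sum>k<m. cnj (K $$ (k, i)) * K $$ (k, j)))"
    by (simp add: sum_list_sum_swap sum_list_const_mult)
  also have "\<dots> = (\<Sum>i<n. \<Sum>j<n. cnj (v $ i) * v $ j * (if i = j then 1 else 0))"
    by (intro sum.cong refl) (simp add: trace_preserving_entries [OF Ks tp])
  also have "\<dots> = (\<Sum>i<n. cnj (v $ i) * v $ i)"
    by (intro sum.cong refl) (simp add: if_distrib [of "(*) _"] cong: if_cong)
  also have "\<dots> = (\<Sum>i<n. v $ i * cnj (v $ i))"
    by (simp only: mult.commute)
  also have "\<dots> = complex_of_real (norm_sq v)"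
    using cscalar_sum [OF v] cscalar_self by metis
  finally show ?thesis by (simp only: of_real_eq_iff)
qed

text \<open>The outcome weights of a unit vector sum to 1, while an empty list or a zero-dimensional
  output would give 0. This is how positivity of dimensions passes from one round of a protocol to
  the next.\<close>

lemma trace_preserving_nonempty:
  assumes "set Ks \<subseteq> carrier_mat m n" "trace_preserving n Ks" "0 < n"
  shows "Ks \<noteq> []" "0 < m"
proof -
  from \<open>0 < n\<close> obtain v where v: "pure_state n v" by (rule pure_state_exists)
  then have s: "(\<Sum>K\<leftarrow>Ks. norm_sq (K *\<^sub>v v)) = 1"
    using sum_norm_sq_trace_preserving [OF assms(1,2)] by (simp add: pure_state_iff)
  then show "Ks \<noteq> []" by auto
  show "0 < m"
  proof (rule ccontr)
    assume "\<not> 0 < m"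
    then have "norm_sq (K *\<^sub>v v) = 0" if "K \<in> set Ks" for K
      using assms(1) that by (auto simp: norm_sq_def)
    then have "(\<Sum>K\<leftarrow>Ks. norm_sq (K *\<^sub>v v)) = (\<Sum>K\<leftarrow>Ks. 0)"
      by (intro arg_cong [of _ _ sum_list] map_cong) auto
    with s show False by simp
  qed
qed

section \<open>The largest overlap under scaling, transposition and measurement\<close>

lemma max_overlap_values:
  assumes "M \<in> carrier_mat m n" "pure_state m x" "pure_state n y"
  shows "(cmod ((M *\<^sub>v y) \<bullet>c x))\<^sup>2 \<le> norm_sq (M *\<^sub>v y)" "norm_sq (M *\<^sub>v y) \<le> frob_sq M"
  using cauchy_schwarz [of "M *\<^sub>v y" m x] norm_sq_mult_mat_vec_le [of M m n y] assms
  by (auto simp: pure_state_iff)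

lemma max_overlap_upper:
  assumes M: "M \<in> carrier_mat m n" and "pure_state m x" "pure_state n y"
  shows "(cmod ((M *\<^sub>v y) \<bullet>c x))\<^sup>2 \<le> max_overlap M"
proof -
  have "bdd_above ((\<lambda>(x, y). (cmod ((M *\<^sub>v y) \<bullet>c x))\<^sup>2) `
      ({x. pure_state (dim_row M) x} \<times> {y. pure_state (dim_col M) y}))"
    using max_overlap_values [OF M] M by (intro bdd_aboveI [of _ "frob_sq M"]) fastforce
  then have "(\<lambda>(x, y). (cmod ((M *\<^sub>v y) \<bullet>c x))\<^sup>2) (x, y) \<le> max_overlap M"
    unfolding max_overlap_def using assms by (intro cSUP_upper) auto
  then show ?thesis by simp
qed

lemma max_overlap_least:
  assumes M: "M \<in> carrier_mat m n" and "0 < m" "0 < n"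
    and "\<And>x y. pure_state m x \<Longrightarrow> pure_state n y \<Longrightarrow> (cmod ((M *\<^sub>v y) \<bullet>c x))\<^sup>2 \<le> C"
  shows "max_overlap M \<le> C"
  unfolding max_overlap_def
proof (rule cSUP_least)
  obtain x y where "pure_state m x" "pure_state n y"
    using assms by (meson pure_state_exists)
  then show "{x. pure_state (dim_row M) x} \<times> {y. pure_state (dim_col M) y} \<noteq> {}"
    using M by auto
qed (use assms in auto)

text \<open>For fixed y the best x is the normalized image of y. If the image vanishes, any unit
  vector x shows that the supremum is nonnegative.\<close>

lemma norm_sq_le_max_overlap:
  assumes M: "M \<in> carrier_mat m n" and m: "0 < m" and y: "pure_state n y"
  shows "norm_sq (M *\<^sub>v y) \<le> max_overlap M"
proof (cases "norm_sq (M *\<^sub>v y) = 0")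
  case True
  from m obtain x where x: "pure_state m x" by (rule pure_state_exists)
  have "0 \<le> (cmod ((M *\<^sub>v y) \<bullet>c x))\<^sup>2" by simp
  also have "\<dots> \<le> max_overlap M" by (rule max_overlap_upper [OF M x y])
  finally show ?thesis using True by simp
next
  case False
  let ?v = "M *\<^sub>v y"
  let ?x = "complex_of_real (1 / sqrt (norm_sq ?v)) \<cdot>\<^sub>v ?v"
  have v: "?v \<in> carrier_vec m" using M y by (auto simp: pure_state_iff)
  have x: "pure_state m ?x" using v False by (rule normalize_pure_state)
  have "?v \<bullet>c ?x = complex_of_real (1 / sqrt (norm_sq ?v)) * (?v \<bullet>c ?v)"
    using v by (simp add: conjugate_smult_vec scalar_prod_smult_distrib [of _ m])
  then have "(cmod (?v \<bullet>c ?x))\<^sup>2 = (1 / sqrt (norm_sq ?v))\<^sup>2 * (norm_sq ?v)\<^sup>2"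
    by (simp add: cscalar_self norm_mult power_mult_distrib norm_divide power_divide)
  also have "\<dots> = norm_sq ?v"
    using False by (simp add: power_divide power2_eq_square)
  finally show ?thesis using max_overlap_upper [OF M x y] by simp
qed

lemma max_overlap_le_frob_sq:
  assumes "M \<in> carrier_mat m n" "0 < m" "0 < n"
  shows "max_overlap M \<le> frob_sq M"
  using max_overlap_values [OF assms(1)] by (intro max_overlap_least [OF assms]) (meson order_trans)

text \<open>Exchanging the two parties is a plain transposition, not an adjoint, so both test
  vectors get conjugated: either side is the sum of M(i,j) y(j) times the conjugate of x(i).\<close>

lemma mult_mat_vec_cscalar_transpose:
  fixes M :: "complex mat"
  assumes "M \<in> carrier_mat m n" "x \<in> carrier_vec m" "y \<in> carrier_vec n"
  shows "(transpose_mat M *\<^sub>v conjugate x) \<bullet>c conjugate y = (M *\<^sub>v y) \<bullet>c x"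
  using assms
  by (simp add: mult_mat_vec_sum scalar_prod_def lessThan_atLeast0 sum_distrib_right sum_distrib_left mult_ac)
    (rule sum.swap)

lemma max_overlap_transpose_le:
  assumes M: "M \<in> carrier_mat m n" and "0 < m" "0 < n"
  shows "max_overlap M \<le> max_overlap (transpose_mat M)"
proof (rule max_overlap_least [OF assms])
  fix x y assume x: "pure_state m x" and y: "pure_state n y"
  have "(cmod ((transpose_mat M *\<^sub>v conjugate x) \<bullet>c conjugate y))\<^sup>2 \<le> max_overlap (transpose_mat M)"
    using M x y by (intro max_overlap_upper pure_state_conjugate) auto
  then show "(cmod ((M *\<^sub>v y) \<bullet>c x))\<^sup>2 \<le> max_overlap (transpose_mat M)"
    using M x y by (subst mult_mat_vec_cscalar_transpose [OF M, symmetric]) (auto simp: pure_state_iff)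
qed

lemma max_overlap_transpose:
  assumes M: "M \<in> carrier_mat m n" and "0 < m" "0 < n"
  shows "max_overlap (transpose_mat M) = max_overlap M"
  using max_overlap_transpose_le [OF assms] max_overlap_transpose_le [of "transpose_mat M" n m] assms
  by simp

lemma frob_sq_transpose: "frob_sq (transpose_mat M) = frob_sq M"
  unfolding frob_sq_def by (subst sum.swap) simp

lemma smult_mat_mult_vec:
  fixes c :: complex
  assumes "M \<in> carrier_mat m n" "v \<in> carrier_vec n"
  shows "(c \<cdot>\<^sub>m M) *\<^sub>v v = c \<cdot>\<^sub>v (M *\<^sub>v v)"
  using assms by (intro eq_vecI) (auto simp: scalar_prod_def sum_distrib_left mult_ac)

lemma max_overlap_smult:
  assumes M: "M \<in> carrier_mat m n" and "0 < m" "0 < n"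
  shows "max_overlap (c \<cdot>\<^sub>m M) = (cmod c)\<^sup>2 * max_overlap M"
proof -
  \<comment> \<open>One inequality for all scalars suffices: for nonzero c, the reverse one is its
    instance for the factor 1 / c.\<close>
  have le: "max_overlap (c \<cdot>\<^sub>m M) \<le> (cmod c)\<^sup>2 * max_overlap M" if M: "M \<in> carrier_mat m n" for c M
  proof (rule max_overlap_least [of _ m n])
    fix x y assume x: "pure_state m x" and y: "pure_state n y"
    have "((c \<cdot>\<^sub>m M) *\<^sub>v y) \<bullet>c x = c * ((M *\<^sub>v y) \<bullet>c x)"
      using M x y by (simp add: pure_state_iff smult_mat_mult_vec smult_scalar_prod_distrib [of _ m])
    then show "(cmod (((c \<cdot>\<^sub>m M) *\<^sub>v y) \<bullet>c x))\<^sup>2 \<le> (cmod c)\<^sup>2 * max_overlap M"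
      using max_overlap_upper [OF M x y] by (simp add: norm_mult power_mult_distrib mult_left_mono)
  qed (use M assms in auto)
  show ?thesis
  proof (cases "c = 0")
    case True
    from assms obtain x y where "pure_state m x" "pure_state n y"
      by (meson pure_state_exists)
    then have "0 \<le> max_overlap (c \<cdot>\<^sub>m M)"
      using max_overlap_upper [of "c \<cdot>\<^sub>m M" m n x y] M by (meson order_trans smult_carrier_mat zero_le_power2)
    with le [OF M, of c] True show ?thesis by simp
  next
    case False
    have "(1 / c) \<cdot>\<^sub>m (c \<cdot>\<^sub>m M) = M"
      using False by (intro eq_matI) auto
    then have "max_overlap M \<le> (cmod (1 / c))\<^sup>2 * max_overlap (c \<cdot>\<^sub>m M)"
      using le [of "c \<cdot>\<^sub>m M" "1 / c"] M by simp
    then have "(cmod c)\<^sup>2 * max_overlap M \<le> max_overlap (c \<cdot>\<^sub>m M)"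
      using False by (simp add: norm_divide power_divide field_simps)
    with le [OF M, of c] show ?thesis by simp
  qed
qed

text \<open>One and the same y is used for all outcomes, whereas \<open>max_overlap (A * M)\<close>
  may choose the best y for each A; hence only an inequality.\<close>

lemma max_overlap_measurement:
  assumes As: "set As \<subseteq> carrier_mat k m" and tp: "trace_preserving m As"
    and M: "M \<in> carrier_mat m n" and "0 < m" "0 < n"
  shows "max_overlap M \<le> (\<Sum>A\<leftarrow>As. max_overlap (A * M))"
proof (rule max_overlap_least [OF M \<open>0 < m\<close> \<open>0 < n\<close>])
  have k: "0 < k" by (rule trace_preserving_nonempty [OF As tp \<open>0 < m\<close>])
  fix x y assume x: "pure_state m x" and y: "pure_state n y"
  then have My: "M *\<^sub>v y \<in> carrier_vec m" using M by (auto simp: pure_state_iff)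
  have "(cmod ((M *\<^sub>v y) \<bullet>c x))\<^sup>2 \<le> norm_sq (M *\<^sub>v y)"
    by (rule max_overlap_values [OF M x y])
  also have "\<dots> = (\<Sum>A\<leftarrow>As. norm_sq (A *\<^sub>v (M *\<^sub>v y)))"
    by (rule sum_norm_sq_trace_preserving [OF As tp My, symmetric])
  also have "\<dots> \<le> (\<Sum>A\<leftarrow>As. max_overlap (A * M))"
  proof (rule sum_list_mono)
    fix A assume "A \<in> set As"
    then have A: "A \<in> carrier_mat k m" using As by auto
    then show "norm_sq (A *\<^sub>v (M *\<^sub>v y)) \<le> max_overlap (A * M)"
      using norm_sq_le_max_overlap [of "A * M" k n y] k M y assoc_mult_mat_vec [OF A M, of y]
      by (simp add: pure_state_iff)
  qed
  finally show "(cmod ((M *\<^sub>v y) \<bullet>c x))\<^sup>2 \<le> (\<Sum>A\<leftarrow>As. max_overlap (A * M))" .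
qed

lemma frob_sq_columns: "frob_sq M = (\<Sum>j<dim_col M. norm_sq (col M j))"
  unfolding frob_sq_def norm_sq_def by (subst sum.swap) simp

text \<open>Norm preservation applied to each column; no optimization is involved, so equality
  holds.\<close>

lemma frob_sq_measurement:
  assumes As: "set As \<subseteq> carrier_mat k m" and tp: "trace_preserving m As"
    and M: "M \<in> carrier_mat m n"
  shows "(\<Sum>A\<leftarrow>As. frob_sq (A * M)) = frob_sq M"
proof -
  have "(\<Sum>A\<leftarrow>As. frob_sq (A * M)) = (\<Sum>A\<leftarrow>As. \<Sum>j<n. norm_sq (A *\<^sub>v col M j))"
  proof (intro arg_cong [of _ _ sum_list] map_cong refl)
    fix A assume "A \<in> set As"
    then have A: "A \<in> carrier_mat k m" using As by auto
    show "frob_sq (A * M) = (\<Sum>j<n. norm_sq (A *\<^sub>v col M j))"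
      unfolding frob_sq_columns using M by (intro sum.cong) (auto simp: col_mult2 [OF A M] simp del: col_mult)
  qed
  also have "\<dots> = (\<Sum>j<n. norm_sq (col M j))"
    unfolding sum_list_sum_swap
    using M by (intro sum.cong refl sum_norm_sq_trace_preserving [OF As tp]) auto
  finally show ?thesis using M by (simp add: frob_sq_columns)
qed

subsection \<open>Decompositions under local operations\<close>

definition unvec :: "nat \<Rightarrow> nat \<Rightarrow> complex vec \<Rightarrow> complex mat" where
  "unvec m n \<phi> = mat m n (\<lambda>(i, j). \<phi> $ (i * n + j))"

definition vector_decomposition :: "nat \<Rightarrow> complex mat \<Rightarrow> complex vec list \<Rightarrow> bool" where
  "vector_decomposition n \<rho> F \<longleftrightarrow> set F \<subseteq> carrier_vec n \<and> (\<Sum>\<phi>\<leftarrow>F. norm_sq \<phi>) = 1 \<and>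
     \<rho> = mat_sum n n (map ketbra F)"

text \<open>For \<phi> = sqrt p \<psi> with a unit vector \<psi>, this is p times the minimal
  texture of \<psi> over product bases.\<close>

definition vector_cost :: "nat \<Rightarrow> nat \<Rightarrow> complex vec \<Rightarrow> real" where
  "vector_cost m n \<phi> = norm_sq \<phi> - max_overlap (unvec m n \<phi>)"

lemma unvec_carrier [simp]: "unvec m n \<phi> \<in> carrier_mat m n"
  by (simp add: unvec_def)

lemma unvec_index [simp]: "i < m \<Longrightarrow> j < n \<Longrightarrow> unvec m n \<phi> $$ (i, j) = \<phi> $ (i * n + j)"
  by (simp add: unvec_def)

lemma pair_index_less:
  assumes "i < m" "j < n"
  shows "i * n + j < m * (n::nat)"
proof -
  have "i * n + j < Suc i * n" using assms by simp
  also have "\<dots> \<le> m * n" using assms by (intro mult_le_mono) auto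
  finally show ?thesis .
qed

lemma frob_sq_unvec: "\<phi> \<in> carrier_vec (m * n) \<Longrightarrow> frob_sq (unvec m n \<phi>) = norm_sq \<phi>"
  by (simp add: frob_sq_def norm_sq_def sum_prod_index unvec_def)

lemma tensor_mat_carrier:
  "A \<in> carrier_mat mA nA \<Longrightarrow> B \<in> carrier_mat mB nB \<Longrightarrow>
    tensor_mat A B \<in> carrier_mat (mA * mB) (nA * nB)"
  by (simp add: tensor_mat_def)

text \<open>Row indices belong to A and column indices to B. Splitting the summation index of the
  tensor product into a pair gives a left multiplication by A and a right one by the transpose of
  B.\<close>

lemma unvec_tensor_mat:
  assumes A: "A \<in> carrier_mat mA nA" and B: "B \<in> carrier_mat mB nB"
    and \<phi>: "\<phi> \<in> carrier_vec (nA * nB)"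
  shows "unvec mA mB (tensor_mat A B *\<^sub>v \<phi>) = A * unvec nA nB \<phi> * transpose_mat B"
proof (rule eq_matI)
  fix i k assume "i < dim_row (A * unvec nA nB \<phi> * transpose_mat B)"
    and "k < dim_col (A * unvec nA nB \<phi> * transpose_mat B)"
  then have i: "i < mA" and k: "k < mB" using A B by auto
  have ik: "i * mB + k < mA * mB" using i k by (rule pair_index_less)
  have "unvec mA mB (tensor_mat A B *\<^sub>v \<phi>) $$ (i, k) =
      (\<Sum>q<nA * nB. tensor_mat A B $$ (i * mB + k, q) * \<phi> $ q)"
    using i k ik mult_mat_vec_sum [OF tensor_mat_carrier [OF A B] \<phi> ik] by simp
  also have "\<dots> = (\<Sum>j<nA. \<Sum>l<nB. A $$ (i, j) * \<phi> $ (j * nB + l) * B $$ (k, l))"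
    unfolding sum_prod_index
  proof (intro sum.cong refl)
    fix j l assume "j \<in> {..<nA}" "l \<in> {..<nB}"
    then have "j < nA" "l < nB" by auto
    then show "tensor_mat A B $$ (i * mB + k, j * nB + l) * \<phi> $ (j * nB + l) =
        A $$ (i, j) * \<phi> $ (j * nB + l) * B $$ (k, l)"
      using A B i k ik pair_index_less [of j nA l nB] by (simp add: tensor_mat_def)
  qed
  also have "\<dots> = (\<Sum>l<nB. (\<Sum>j<nA. A $$ (i, j) * \<phi> $ (j * nB + l)) * B $$ (k, l))"
    unfolding sum_distrib_right by (rule sum.swap)
  also have "\<dots> = (A * unvec nA nB \<phi> * transpose_mat B) $$ (i, k)"
    using A B i k by (simp add: scalar_prod_def lessThan_atLeast0 unvec_def)
  finally show "unvec mA mB (tensor_mat A B *\<^sub>v \<phi>) $$ (i, k) =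
      (A * unvec nA nB \<phi> * transpose_mat B) $$ (i, k)" .
qed (use A B in \<open>auto simp: unvec_def\<close>)

lemma ketbra_carrier [simp]: "v \<in> carrier_vec n \<Longrightarrow> ketbra v \<in> carrier_mat n n"
  by (simp add: ketbra_def)

lemma ketbra_mult:
  assumes K: "K \<in> carrier_mat m n" and v: "v \<in> carrier_vec n"
  shows "K * ketbra v * mat_adjoint K = ketbra (K *\<^sub>v v)"
proof (rule eq_matI)
  have a: "mat_adjoint K \<in> carrier_mat n m" using K by (rule mat_adjoint_carrier)
  fix i j assume "i < dim_row (ketbra (K *\<^sub>v v))" "j < dim_col (ketbra (K *\<^sub>v v))"
  then have i: "i < m" and j: "j < m" using K by (auto simp: ketbra_def)
  have "(K * ketbra v * mat_adjoint K) $$ (i, j) =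
      (\<Sum>l<n. (\<Sum>k<n. K $$ (i, k) * (v $ k * cnj (v $ l))) * cnj (K $$ (j, l)))"
    using K v a i j
    by (simp add: scalar_prod_def lessThan_atLeast0 ketbra_def mat_adjoint_index [OF K])
  also have "\<dots> = (\<Sum>l<n. (\<Sum>k<n. K $$ (i, k) * v $ k) * cnj (K $$ (j, l) * v $ l))"
    unfolding sum_distrib_right by (simp add: mult_ac)
  also have "\<dots> = (\<Sum>k<n. K $$ (i, k) * v $ k) * cnj (\<Sum>l<n. K $$ (j, l) * v $ l)"
    by (simp only: cnj_sum sum_distrib_left)
  also have "\<dots> = ketbra (K *\<^sub>v v) $$ (i, j)"
    using K v i j by (simp add: ketbra_def mult_mat_vec_sum [OF K v] del: index_mult_mat_vec)
  finally show "(K * ketbra v * mat_adjoint K) $$ (i, j) = ketbra (K *\<^sub>v v) $$ (i, j)" .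
qed (use K mat_adjoint_carrier [OF K] in \<open>auto simp: ketbra_def\<close>)

section \<open>Kraus maps on sums of rank-one matrices\<close>

lemma mat_sum_Cons: "mat_sum r c (M # Ms) = M + mat_sum r c Ms"
  by (simp add: mat_sum_def)

lemma mat_sum_append:
  assumes "set Ms \<subseteq> carrier_mat r c" "set Ns \<subseteq> carrier_mat r c"
  shows "mat_sum r c (Ms @ Ns) = mat_sum r c Ms + mat_sum r c Ns"
  using assms(1)
proof (induction Ms)
  case Nil
  then show ?case using mat_sum_carrier [OF assms(2)] by (simp add: mat_sum_def)
next
  case (Cons M Ms)
  then show ?case
    using mat_sum_carrier [OF assms(2)] mat_sum_carrier [of Ms r c]
    by (auto simp: mat_sum_Cons intro!: assoc_add_mat [symmetric])
qed

lemma kraus_summand_carrier: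
  assumes "set L \<subseteq> carrier_mat m n" "X \<in> carrier_mat n n"
  shows "set (map (\<lambda>K. K * X * mat_adjoint K) L) \<subseteq> carrier_mat m m"
proof -
  have "K * X * mat_adjoint K \<in> carrier_mat m m" if "K \<in> set L" for K
    using assms that by (intro mult_carrier_mat [of _ m n] mat_adjoint_carrier) auto
  then show ?thesis by auto
qed

lemma kraus_map_carrier:
  "set L \<subseteq> carrier_mat m n \<Longrightarrow> X \<in> carrier_mat n n \<Longrightarrow> kraus_map m L X \<in> carrier_mat m m"
  using mat_sum_carrier [OF kraus_summand_carrier] by (simp add: kraus_map_def)

lemma kraus_map_add:
  assumes "set L \<subseteq> carrier_mat m n" "X \<in> carrier_mat n n" "Y \<in> carrier_mat n n"
  shows "kraus_map m L (X + Y) = kraus_map m L X + kraus_map m L Y"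
  using assms(1)
proof (induction L)
  case Nil
  then show ?case by (simp add: kraus_map_def mat_sum_def)
next
  case (Cons K L)
  then have K: "K \<in> carrier_mat m n" and L: "set L \<subseteq> carrier_mat m n" by auto
  note a = mat_adjoint_carrier [OF K]
  have KX: "K * X \<in> carrier_mat m n" and KY: "K * Y \<in> carrier_mat m n"
    using K assms by (auto simp del: index_mult_mat)
  have 1: "K * (X + Y) * mat_adjoint K = K * X * mat_adjoint K + K * Y * mat_adjoint K"
    using mult_add_distrib_mat [OF K assms(2,3)] add_mult_distrib_mat [OF KX KY a] by simp
  have c: "K * X * mat_adjoint K \<in> carrier_mat m m" "K * Y * mat_adjoint K \<in> carrier_mat m m"
    using mult_carrier_mat [OF KX a] mult_carrier_mat [OF KY a] by auto
  note d = kraus_map_carrier [OF L assms(2)] kraus_map_carrier [OF L assms(3)]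
  have step: "kraus_map m (K # L) Z = K * Z * mat_adjoint K + kraus_map m L Z" for Z
    by (simp add: kraus_map_def mat_sum_Cons)
  show ?case
    unfolding step 1 Cons.IH [OF L] using c d
    by (intro eq_matI) (auto simp del: index_mult_mat)
qed

lemma kraus_map_zero:
  assumes "set L \<subseteq> carrier_mat m n"
  shows "kraus_map m L (0\<^sub>m n n) = 0\<^sub>m m m"
  using assms
proof (induction L)
  case (Cons K L)
  then have K: "K \<in> carrier_mat m n" by auto
  have "K * 0\<^sub>m n n * mat_adjoint K = 0\<^sub>m m m"
    using K mat_adjoint_carrier [OF K] by simp
  with Cons show ?case by (simp add: kraus_map_def mat_sum_Cons)
qed (simp add: kraus_map_def mat_sum_def)

text \<open>Since the weights sit inside the vectors, additivity of the Kraus map is all the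
  linearity that the induction uses.\<close>

lemma kraus_map_ketbras:
  assumes L: "set L \<subseteq> carrier_mat m n" and F: "set F \<subseteq> carrier_vec n"
  shows "kraus_map m L (mat_sum n n (map ketbra F)) =
    mat_sum m m (map ketbra [K *\<^sub>v \<phi>. \<phi> \<leftarrow> F, K \<leftarrow> L])"
  using F
proof (induction F)
  case Nil
  then show ?case using kraus_map_zero [OF L] by (simp add: mat_sum_def)
next
  case (Cons \<phi> F)
  then have \<phi>: "\<phi> \<in> carrier_vec n" and F: "set F \<subseteq> carrier_vec n" by auto
  have c: "ketbra \<phi> \<in> carrier_mat n n" "mat_sum n n (map ketbra F) \<in> carrier_mat n n"
    using \<phi> F by (auto intro!: mat_sum_carrier ketbra_carrier)
  have "kraus_map m L (ketbra \<phi>) = mat_sum m m (map (\<lambda>K. ketbra (K *\<^sub>v \<phi>)) L)"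
    unfolding kraus_map_def using L \<phi>
    by (intro arg_cong [of _ _ "mat_sum m m"] map_cong) (auto simp: ketbra_mult)
  moreover have "set (map (\<lambda>K. ketbra (K *\<^sub>v \<phi>)) L) \<subseteq> carrier_mat m m"
    using L by (auto intro!: ketbra_carrier mult_mat_vec_carrier \<phi>)
  moreover have "set (map ketbra [K *\<^sub>v \<phi>. \<phi> \<leftarrow> F, K \<leftarrow> L]) \<subseteq> carrier_mat m m"
    using L F by (auto intro!: ketbra_carrier mult_mat_vec_carrier)
  ultimately show ?case
    using kraus_map_add [OF L c] Cons.IH [OF F]
    by (simp add: mat_sum_Cons mat_sum_append o_def)
qed

section \<open>Quantities that do not decrease on average\<close>

text \<open>A general g lets one argument about protocols serve both the largest overlap and the
  norm. The norm is conserved exactly, which is obtained from the instances g and - g.\<close>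

definition measurement_mono :: "(complex mat \<Rightarrow> real) \<Rightarrow> bool" where
  "measurement_mono g \<longleftrightarrow>
     (\<forall>k m n As M. set As \<subseteq> carrier_mat k m \<longrightarrow> trace_preserving m As \<longrightarrow> M \<in> carrier_mat m n \<longrightarrow>
        0 < m \<longrightarrow> 0 < n \<longrightarrow> g M \<le> (\<Sum>A\<leftarrow>As. g (A * M))) \<and>
     (\<forall>m n M. M \<in> carrier_mat m n \<longrightarrow> 0 < m \<longrightarrow> 0 < n \<longrightarrow> g (transpose_mat M) = g M)"

lemma measurement_mono_max_overlap: "measurement_mono max_overlap"
  unfolding measurement_mono_def using max_overlap_measurement max_overlap_transpose by blast

lemma measurement_mono_frob_sq: "measurement_mono frob_sq" "measurement_mono (\<lambda>M. - frob_sq M)"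
proof -
  have neg: "(\<Sum>x\<leftarrow>xs. - f x) = - (\<Sum>x\<leftarrow>xs. f x)" for f :: "complex mat \<Rightarrow> real" and xs
    by (induction xs) simp_all
  show "measurement_mono frob_sq" "measurement_mono (\<lambda>M. - frob_sq M)"
    by (auto simp: measurement_mono_def neg frob_sq_measurement frob_sq_transpose)
qed

text \<open>Kraus operators acting locally multiply the coefficient matrix of a vector from the left or,
  transposed, from the right. So a transposition invariant \<open>g\<close> that does not decrease on average
  under multiplications from the left does not decrease on average under one-way
  protocols.\<close>

lemma
  fixes g :: "complex mat \<Rightarrow> real" and ops :: "(complex mat list \<times> complex mat list) list"
  assumes g: "measurement_mono g"
    and M: "M \<in> carrier_mat nA nB" and pos: "0 < nA" "0 < nB"
    and ops: "\<And>As Bs. (As, Bs) \<in> set ops \<Longrightarrow> set As \<subseteq> carrier_mat mA nA"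
      "\<And>As Bs. (As, Bs) \<in> set ops \<Longrightarrow> set Bs \<subseteq> carrier_mat mB nB"
  shows one_way_AB_mono: "\<lbrakk>\<And>As Bs. (As, Bs) \<in> set ops \<Longrightarrow> trace_preserving nB Bs;
      trace_preserving nA (concat (map fst ops))\<rbrakk> \<Longrightarrow> 0 < mA \<and> 0 < mB \<and>
      g M \<le> (\<Sum>(As, Bs)\<leftarrow>ops. \<Sum>A\<leftarrow>As. \<Sum>B\<leftarrow>Bs. g (A * M * transpose_mat B))"
    and one_way_BA_mono: "\<lbrakk>\<And>As Bs. (As, Bs) \<in> set ops \<Longrightarrow> trace_preserving nA As;
      trace_preserving nB (concat (map snd ops))\<rbrakk> \<Longrightarrow> 0 < mA \<and> 0 < mB \<and>
      g M \<le> (\<Sum>(As, Bs)\<leftarrow>ops. \<Sum>A\<leftarrow>As. \<Sum>B\<leftarrow>Bs. g (A * M * transpose_mat B))"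
proof -
  have meas: "g M \<le> (\<Sum>A\<leftarrow>As. g (A * M))"
    if "set As \<subseteq> carrier_mat k m" "trace_preserving m As" "M \<in> carrier_mat m n" "0 < m" "0 < n"
    for k m n As M
    using g that by (auto simp: measurement_mono_def)
  have transp: "g (transpose_mat M) = g M" if "M \<in> carrier_mat m n" "0 < m" "0 < n" for m n M
    using g that by (auto simp: measurement_mono_def)
  have Ac: "set (concat (map fst ops)) \<subseteq> carrier_mat mA nA"
    and Bc: "set (concat (map snd ops)) \<subseteq> carrier_mat mB nB"
    using ops by fastforce+
  {
    assume tpB: "\<And>As Bs. (As, Bs) \<in> set ops \<Longrightarrow> trace_preserving nB Bs"
      and tpA: "trace_preserving nA (concat (map fst ops))"
    have mA: "0 < mA" by (rule trace_preserving_nonempty [OF Ac tpA pos(1)])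
    \<comment> \<open>The dimension \<open>mB\<close> is controlled by the channel that B applies
      after some outcome, so an outcome must exist.\<close>
    have "ops \<noteq> []" using trace_preserving_nonempty [OF Ac tpA pos(1)] by auto
    then obtain As Bs where "(As, Bs) \<in> set ops" by (cases ops) auto
    then have mB: "0 < mB" using trace_preserving_nonempty [OF ops(2) tpB pos(2)] by blast
    have "g M \<le> (\<Sum>A\<leftarrow>concat (map fst ops). g (A * M))"
      by (rule meas [OF Ac tpA M pos])
    also have "\<dots> = (\<Sum>(As, Bs)\<leftarrow>ops. \<Sum>A\<leftarrow>As. g (A * M))"
      by (simp add: sum_list_map_concat o_def split_def)
    also have "\<dots> \<le> (\<Sum>(As, Bs)\<leftarrow>ops. \<Sum>A\<leftarrow>As. \<Sum>B\<leftarrow>Bs. g (A * M * transpose_mat B))"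
    proof (rule sum_list_mono, clarify, rule sum_list_mono)
      fix As Bs A assume o: "(As, Bs) \<in> set ops" and "A \<in> set As"
      then have A: "A \<in> carrier_mat mA nA" using ops by auto
      then have AM: "A * M \<in> carrier_mat mA nB" using M by simp
      have "g (A * M) = g (transpose_mat (A * M))"
        by (rule transp [OF AM mA pos(2), symmetric])
      also have "\<dots> \<le> (\<Sum>B\<leftarrow>Bs. g (B * transpose_mat (A * M)))"
        by (rule meas [OF ops(2) [OF o] tpB [OF o] _ pos(2) mA]) (use AM in simp)
      also have "\<dots> = (\<Sum>B\<leftarrow>Bs. g (A * M * transpose_mat B))"
      proof (intro arg_cong [of _ _ sum_list] map_cong refl)
        fix B assume "B \<in> set Bs"
        then have B: "B \<in> carrier_mat mB nB" using ops(2) [OF o] by auto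
        then have "transpose_mat (A * M * transpose_mat B) = B * transpose_mat (A * M)"
          using transpose_mult [OF AM, of "transpose_mat B"] by simp
        then show "g (B * transpose_mat (A * M)) = g (A * M * transpose_mat B)"
          using transp [of "A * M * transpose_mat B" mA mB] AM B mA mB
          by (simp del: index_mult_mat)
      qed
      finally show "g (A * M) \<le> (\<Sum>B\<leftarrow>Bs. g (A * M * transpose_mat B))" .
    qed
    finally show "0 < mA \<and> 0 < mB \<and>
      g M \<le> (\<Sum>(As, Bs)\<leftarrow>ops. \<Sum>A\<leftarrow>As. \<Sum>B\<leftarrow>Bs. g (A * M * transpose_mat B))"
      using mA mB by simp
  next
    assume tpA: "\<And>As Bs. (As, Bs) \<in> set ops \<Longrightarrow> trace_preserving nA As"
      and tpB: "trace_preserving nB (concat (map snd ops))"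
    have mB: "0 < mB" by (rule trace_preserving_nonempty [OF Bc tpB pos(2)])
    have "ops \<noteq> []" using trace_preserving_nonempty [OF Bc tpB pos(2)] by auto
    then obtain As Bs where "(As, Bs) \<in> set ops" by (cases ops) auto
    then have mA: "0 < mA" using trace_preserving_nonempty [OF ops(1) tpA pos(1)] by blast
    have "g M = g (transpose_mat M)"
      by (rule transp [OF M pos, symmetric])
    also have "\<dots> \<le> (\<Sum>B\<leftarrow>concat (map snd ops). g (B * transpose_mat M))"
      using M pos by (intro meas [OF Bc tpB]) auto
    also have "\<dots> = (\<Sum>(As, Bs)\<leftarrow>ops. \<Sum>B\<leftarrow>Bs. g (B * transpose_mat M))"
      by (simp add: sum_list_map_concat o_def split_def)
    also have "\<dots> \<le> (\<Sum>(As, Bs)\<leftarrow>ops. \<Sum>B\<leftarrow>Bs. \<Sum>A\<leftarrow>As. g (A * M * transpose_mat B))"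
    proof (rule sum_list_mono, clarify, rule sum_list_mono)
      fix As Bs B assume o: "(As, Bs) \<in> set ops" and "B \<in> set Bs"
      then have B: "B \<in> carrier_mat mB nB" using ops(2) [OF o] by auto
      then have MB: "M * transpose_mat B \<in> carrier_mat nA mB" using M by simp
      have "transpose_mat (M * transpose_mat B) = B * transpose_mat M"
        using transpose_mult [OF M, of "transpose_mat B"] B by simp
      then have "g (B * transpose_mat M) = g (M * transpose_mat B)"
        using transp [OF MB pos(1) mB] by simp
      also have "\<dots> \<le> (\<Sum>A\<leftarrow>As. g (A * (M * transpose_mat B)))"
        by (rule meas [OF ops(1) tpA MB pos(1) mB, OF o o])
      also have "\<dots> = (\<Sum>A\<leftarrow>As. g (A * M * transpose_mat B))"
      proof (intro arg_cong [of _ _ sum_list] map_cong refl)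
        fix A assume "A \<in> set As"
        then have "A \<in> carrier_mat mA nA" using ops o by auto
        then show "g (A * (M * transpose_mat B)) = g (A * M * transpose_mat B)"
          using M B by (subst assoc_mult_mat [of _ mA nA _ nB _ mB]) auto
      qed
      finally show "g (B * transpose_mat M) \<le> (\<Sum>A\<leftarrow>As. g (A * M * transpose_mat B))" .
    qed
    \<comment> \<open>B measures first here, which put the sum over \<open>Bs\<close> outside; the
      exchange restores the order used for both directions.\<close>
    also have "\<dots> = (\<Sum>(As, Bs)\<leftarrow>ops. \<Sum>A\<leftarrow>As. \<Sum>B\<leftarrow>Bs. g (A * M * transpose_mat B))"
      by (intro arg_cong [of _ _ sum_list] map_cong refl) (auto intro: sum_list_swap)
    finally show "0 < mA \<and> 0 < mB \<and>
      g M \<le> (\<Sum>(As, Bs)\<leftarrow>ops. \<Sum>A\<leftarrow>As. \<Sum>B\<leftarrow>Bs. g (A * M * transpose_mat B))"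
      using mA mB by simp
  }
qed

text \<open>All that is remembered of a one-way protocol, whatever its direction. The positive
  output dimensions allow the next round to start.\<close>

definition local_kraus :: "nat \<Rightarrow> nat \<Rightarrow> nat \<Rightarrow> nat \<Rightarrow> complex mat list \<Rightarrow> bool" where
  "local_kraus nA nB mA mB L \<longleftrightarrow> set L \<subseteq> carrier_mat (mA * mB) (nA * nB) \<and> 0 < mA \<and> 0 < mB \<and>
     (\<forall>\<phi> \<in> carrier_vec (nA * nB). (\<Sum>K\<leftarrow>L. norm_sq (K *\<^sub>v \<phi>)) = norm_sq \<phi> \<and>
        max_overlap (unvec nA nB \<phi>) \<le> (\<Sum>K\<leftarrow>L. max_overlap (unvec mA mB (K *\<^sub>v \<phi>))))"

lemma local_krausI:
  fixes ops :: "(complex mat list \<times> complex mat list) list"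
  defines "L \<equiv> [tensor_mat A B. (As, Bs) \<leftarrow> ops, A \<leftarrow> As, B \<leftarrow> Bs]"
  assumes pos: "0 < nA" "0 < nB"
    and ops: "\<And>As Bs. (As, Bs) \<in> set ops \<Longrightarrow> set As \<subseteq> carrier_mat mA nA"
      "\<And>As Bs. (As, Bs) \<in> set ops \<Longrightarrow> set Bs \<subseteq> carrier_mat mB nB"
    and mono: "\<And>g M. \<lbrakk>measurement_mono g; M \<in> carrier_mat nA nB\<rbrakk> \<Longrightarrow> 0 < mA \<and> 0 < mB \<and>
      g M \<le> (\<Sum>(As, Bs)\<leftarrow>ops. \<Sum>A\<leftarrow>As. \<Sum>B\<leftarrow>Bs. g (A * M * transpose_mat B))"
  shows "local_kraus nA nB mA mB L"
proof -
  have L: "set L \<subseteq> carrier_mat (mA * mB) (nA * nB)"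
    using ops by (fastforce simp: L_def intro!: tensor_mat_carrier)
  have neg: "(\<Sum>x\<leftarrow>xs. - f x) = - (\<Sum>x\<leftarrow>xs. f x)" for f :: "complex mat \<Rightarrow> real" and xs
    by (induction xs) simp_all
  \<comment> \<open>Only the positivity part of \<open>mono\<close> is extracted, so any matrix will
    do.\<close>
  have pos': "0 < mA" "0 < mB"
    using mono [of max_overlap "0\<^sub>m nA nB"] measurement_mono_max_overlap by auto
  have eq: "(\<Sum>K\<leftarrow>L. g (unvec mA mB (K *\<^sub>v \<phi>))) =
      (\<Sum>(As, Bs)\<leftarrow>ops. \<Sum>A\<leftarrow>As. \<Sum>B\<leftarrow>Bs. g (A * unvec nA nB \<phi> * transpose_mat B))"
    if \<phi>: "\<phi> \<in> carrier_vec (nA * nB)" for g :: "complex mat \<Rightarrow> real" and \<phi>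
  proof -
    have "(\<Sum>K\<leftarrow>L. g (unvec mA mB (K *\<^sub>v \<phi>))) =
        (\<Sum>(As, Bs)\<leftarrow>ops. \<Sum>A\<leftarrow>As. \<Sum>B\<leftarrow>Bs. g (unvec mA mB (tensor_mat A B *\<^sub>v \<phi>)))"
      by (simp add: L_def sum_list_map_concat o_def split_def)
    also have "\<dots> = (\<Sum>(As, Bs)\<leftarrow>ops. \<Sum>A\<leftarrow>As. \<Sum>B\<leftarrow>Bs. g (A * unvec nA nB \<phi> * transpose_mat B))"
      by (intro arg_cong [of _ _ sum_list] map_cong refl, clarify,
          intro arg_cong [of _ _ sum_list] map_cong refl arg_cong [of _ _ g] unvec_tensor_mat \<phi>)
        (use ops in blast)+
    finally show ?thesis .
  qed
  have "(\<Sum>K\<leftarrow>L. norm_sq (K *\<^sub>v \<phi>)) = norm_sq \<phi> \<and>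
      max_overlap (unvec nA nB \<phi>) \<le> (\<Sum>K\<leftarrow>L. max_overlap (unvec mA mB (K *\<^sub>v \<phi>)))"
    if \<phi>: "\<phi> \<in> carrier_vec (nA * nB)" for \<phi>
  proof
    let ?M = "unvec nA nB \<phi>"
    have "max_overlap ?M \<le> (\<Sum>(As, Bs)\<leftarrow>ops. \<Sum>A\<leftarrow>As. \<Sum>B\<leftarrow>Bs. max_overlap (A * ?M * transpose_mat B))"
      using mono [of max_overlap ?M] measurement_mono_max_overlap by auto
    then show "max_overlap ?M \<le> (\<Sum>K\<leftarrow>L. max_overlap (unvec mA mB (K *\<^sub>v \<phi>)))"
      by (simp add: eq [OF \<phi>])
    have "(\<Sum>K\<leftarrow>L. norm_sq (K *\<^sub>v \<phi>)) = (\<Sum>K\<leftarrow>L. frob_sq (unvec mA mB (K *\<^sub>v \<phi>)))"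
      using L \<phi> by (intro arg_cong [of _ _ sum_list] map_cong refl frob_sq_unvec [symmetric]) auto
    moreover have "frob_sq ?M \<le> (\<Sum>K\<leftarrow>L. frob_sq (unvec mA mB (K *\<^sub>v \<phi>)))"
      using mono [of frob_sq ?M] measurement_mono_frob_sq(1) by (simp add: eq [OF \<phi>])
    \<comment> \<open>The instance - \<open>frob_sq\<close> supplies the reverse inequality and
      thereby exact conservation of the norm.\<close>
    moreover have "- frob_sq ?M \<le> (\<Sum>K\<leftarrow>L. - frob_sq (unvec mA mB (K *\<^sub>v \<phi>)))"
      unfolding eq [OF \<phi>, of "\<lambda>M. - frob_sq M"]
      by (rule mono [OF measurement_mono_frob_sq(2), THEN conjunct2, THEN conjunct2]) simp
    ultimately show "(\<Sum>K\<leftarrow>L. norm_sq (K *\<^sub>v \<phi>)) = norm_sq \<phi>"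
      by (simp add: frob_sq_unvec [OF \<phi>] neg)
  qed
  with L pos' show ?thesis by (simp add: local_kraus_def)
qed

lemma one_way_local_kraus:
  assumes "one_way_AB nA nB mA mB \<Lambda> \<or> one_way_BA nA nB mA mB \<Lambda>" and pos: "0 < nA" "0 < nB"
  obtains L where "local_kraus nA nB mA mB L"
    "\<forall>X \<in> carrier_mat (nA * nB) (nA * nB). \<Lambda> X = kraus_map (mA * mB) L X"
  using assms(1)
proof
  assume "one_way_AB nA nB mA mB \<Lambda>"
  then obtain ops where ops:
    "\<And>As Bs. (As, Bs) \<in> set ops \<Longrightarrow> set As \<subseteq> carrier_mat mA nA"
    "\<And>As Bs. (As, Bs) \<in> set ops \<Longrightarrow> set Bs \<subseteq> carrier_mat mB nB"
    "\<And>As Bs. (As, Bs) \<in> set ops \<Longrightarrow> trace_preserving nB Bs"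
    "trace_preserving nA (concat (map fst ops))"
    and \<Lambda>: "\<And>X. X \<in> carrier_mat (nA * nB) (nA * nB) \<Longrightarrow>
      \<Lambda> X = kraus_map (mA * mB) [tensor_mat A B. (As, Bs) \<leftarrow> ops, A \<leftarrow> As, B \<leftarrow> Bs] X"
    unfolding one_way_AB_def by blast
  have "local_kraus nA nB mA mB [tensor_mat A B. (As, Bs) \<leftarrow> ops, A \<leftarrow> As, B \<leftarrow> Bs]"
    using one_way_AB_mono [OF _ _ pos ops]
    by (intro local_krausI [OF pos ops(1,2)]) assumption+
  with \<Lambda> show ?thesis using that by blast
next
  assume "one_way_BA nA nB mA mB \<Lambda>"
  then obtain ops where ops:
    "\<And>As Bs. (As, Bs) \<in> set ops \<Longrightarrow> set As \<subseteq> carrier_mat mA nA"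
    "\<And>As Bs. (As, Bs) \<in> set ops \<Longrightarrow> set Bs \<subseteq> carrier_mat mB nB"
    "\<And>As Bs. (As, Bs) \<in> set ops \<Longrightarrow> trace_preserving nA As"
    "trace_preserving nB (concat (map snd ops))"
    and \<Lambda>: "\<And>X. X \<in> carrier_mat (nA * nB) (nA * nB) \<Longrightarrow>
      \<Lambda> X = kraus_map (mA * mB) [tensor_mat A B. (As, Bs) \<leftarrow> ops, A \<leftarrow> As, B \<leftarrow> Bs] X"
    unfolding one_way_BA_def by blast
  have "local_kraus nA nB mA mB [tensor_mat A B. (As, Bs) \<leftarrow> ops, A \<leftarrow> As, B \<leftarrow> Bs]"
    using one_way_BA_mono [OF _ _ pos ops]
    by (intro local_krausI [OF pos ops(1,2)]) assumption+
  with \<Lambda> show ?thesis using that by blast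
qed

section \<open>Pushing decompositions through LOCC protocols\<close>

lemma vector_decomposition_carrier:
  "vector_decomposition n \<rho> F \<Longrightarrow> \<rho> \<in> carrier_mat n n"
  by (auto simp: vector_decomposition_def intro!: mat_sum_carrier ketbra_carrier)

text \<open>The new list has one vector for each pair of an old vector and a Kraus operator. For
  each old vector the norms add up exactly while the overlaps do not drop in total, so the cost,
  their difference, cannot rise.\<close>

lemma local_kraus_vector_decomposition:
  assumes L: "local_kraus nA nB mA mB L" and F: "vector_decomposition (nA * nB) \<rho> F"
  obtains F' where "vector_decomposition (mA * mB) (kraus_map (mA * mB) L \<rho>) F'"
    "(\<Sum>\<phi>\<leftarrow>F'. vector_cost mA mB \<phi>) \<le> (\<Sum>\<phi>\<leftarrow>F. vector_cost nA nB \<phi>)"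
proof
  let ?F = "[K *\<^sub>v \<phi>. \<phi> \<leftarrow> F, K \<leftarrow> L]"
  have Lc: "set L \<subseteq> carrier_mat (mA * mB) (nA * nB)"
    and norm: "\<And>\<phi>. \<phi> \<in> carrier_vec (nA * nB) \<Longrightarrow> (\<Sum>K\<leftarrow>L. norm_sq (K *\<^sub>v \<phi>)) = norm_sq \<phi>"
    and mono: "\<And>\<phi>. \<phi> \<in> carrier_vec (nA * nB) \<Longrightarrow>
      max_overlap (unvec nA nB \<phi>) \<le> (\<Sum>K\<leftarrow>L. max_overlap (unvec mA mB (K *\<^sub>v \<phi>)))"
    using L by (auto simp: local_kraus_def)
  have Fc: "set F \<subseteq> carrier_vec (nA * nB)" using F by (simp add: vector_decomposition_def)
  have sum: "(\<Sum>\<phi>\<leftarrow>?F. h \<phi>) = (\<Sum>\<phi>\<leftarrow>F. \<Sum>K\<leftarrow>L. h (K *\<^sub>v \<phi>))" for h :: "complex vec \<Rightarrow> real"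
    by (simp add: sum_list_map_concat o_def)
  have "(\<Sum>\<phi>\<leftarrow>?F. norm_sq \<phi>) = (\<Sum>\<phi>\<leftarrow>F. norm_sq \<phi>)"
    unfolding sum using Fc norm by (intro arg_cong [of _ _ sum_list] map_cong refl) auto
  moreover have "set ?F \<subseteq> carrier_vec (mA * mB)"
    using Lc Fc by (auto intro!: mult_mat_vec_carrier)
  ultimately show "vector_decomposition (mA * mB) (kraus_map (mA * mB) L \<rho>) ?F"
    using F kraus_map_ketbras [OF Lc Fc] by (simp add: vector_decomposition_def)
  show "(\<Sum>\<phi>\<leftarrow>?F. vector_cost mA mB \<phi>) \<le> (\<Sum>\<phi>\<leftarrow>F. vector_cost nA nB \<phi>)"
    unfolding sum
  proof (rule sum_list_mono)
    fix \<phi> assume "\<phi> \<in> set F"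
    then have \<phi>: "\<phi> \<in> carrier_vec (nA * nB)" using Fc by auto
    have "(\<Sum>K\<leftarrow>L. vector_cost mA mB (K *\<^sub>v \<phi>)) =
        (\<Sum>K\<leftarrow>L. norm_sq (K *\<^sub>v \<phi>)) - (\<Sum>K\<leftarrow>L. max_overlap (unvec mA mB (K *\<^sub>v \<phi>)))"
      unfolding vector_cost_def by (simp add: sum_list_subtractf)
    then show "(\<Sum>K\<leftarrow>L. vector_cost mA mB (K *\<^sub>v \<phi>)) \<le> vector_cost nA nB \<phi>"
      using norm [OF \<phi>] mono [OF \<phi>] by (simp add: vector_cost_def)
  qed
qed

text \<open>The induction follows one decomposition instead of the infimum. The intermediate
  matrices thus come with a decomposition and with positive dimensions, ready for the following
  round.\<close>

lemma locc_vector_decomposition: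
  assumes "locc nA nB mA mB \<Lambda>" "0 < nA" "0 < nB" "vector_decomposition (nA * nB) \<rho> F"
  shows "0 < mA \<and> 0 < mB \<and> (\<exists>F'. vector_decomposition (mA * mB) (\<Lambda> \<rho>) F' \<and>
    (\<Sum>\<phi>\<leftarrow>F'. vector_cost mA mB \<phi>) \<le> (\<Sum>\<phi>\<leftarrow>F. vector_cost nA nB \<phi>))"
proof -
  have one: "0 < mA \<and> 0 < mB \<and> (\<exists>F'. vector_decomposition (mA * mB) (\<Lambda> \<rho>) F' \<and>
    (\<Sum>\<phi>\<leftarrow>F'. vector_cost mA mB \<phi>) \<le> (\<Sum>\<phi>\<leftarrow>F. vector_cost nA nB \<phi>))"
    if h: "one_way_AB nA nB mA mB \<Lambda> \<or> one_way_BA nA nB mA mB \<Lambda>" "0 < nA" "0 < nB"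
      "vector_decomposition (nA * nB) \<rho> F" for nA nB mA mB \<Lambda> \<rho> F
  proof -
    from one_way_local_kraus [OF h(1-3)] obtain L where L: "local_kraus nA nB mA mB L"
      "\<forall>X \<in> carrier_mat (nA * nB) (nA * nB). \<Lambda> X = kraus_map (mA * mB) L X" .
    have "\<Lambda> \<rho> = kraus_map (mA * mB) L \<rho>"
      using vector_decomposition_carrier [OF h(4)] L(2) by blast
    with local_kraus_vector_decomposition [OF L(1) h(4)] L(1) show ?thesis
      unfolding local_kraus_def by metis
  qed
  from assms show ?thesis
  proof (induction arbitrary: \<rho> F)
    case (comp nA nB kA kB \<Lambda> mA mB \<Gamma>)
    from comp.IH(1) [OF comp.prems] obtain F' where k: "0 < kA" "0 < kB"
      and F': "vector_decomposition (kA * kB) (\<Lambda> \<rho>) F'"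
      and le: "(\<Sum>\<phi>\<leftarrow>F'. vector_cost kA kB \<phi>) \<le> (\<Sum>\<phi>\<leftarrow>F. vector_cost nA nB \<phi>)"
      by blast
    from comp.IH(2) [OF k F'] le show ?case
      unfolding o_apply by (meson order_trans)
  next
    case (AB nA nB mA mB \<Lambda>)
    then show ?case by (intro one) auto
  next
    case (BA nA nB mA mB \<Lambda>)
    then show ?case by (intro one) auto
  qed
qed

subsection \<open>Texture as the defect of the largest overlap with a product vector\<close>

lemma tensor_vec_carrier:
  "x \<in> carrier_vec m \<Longrightarrow> y \<in> carrier_vec n \<Longrightarrow> tensor_vec x y \<in> carrier_vec (m * n)"
  by (simp add: tensor_vec_def)

lemma tensor_vec_index:
  assumes "x \<in> carrier_vec m" "y \<in> carrier_vec n" "i < m" "j < n"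
  shows "tensor_vec x y $ (i * n + j) = x $ i * y $ j"
  using assms pair_index_less [of i m j n] by (simp add: tensor_vec_def)

lemma overlap_tensor_vec:
  assumes x: "x \<in> carrier_vec m" and y: "y \<in> carrier_vec n"
  shows "\<phi> \<bullet>c tensor_vec x y = (\<Sum>i<m. \<Sum>j<n. \<phi> $ (i * n + j) * cnj (x $ i) * cnj (y $ j))"
  unfolding cscalar_sum [OF tensor_vec_carrier [OF x y]] sum_prod_index
  by (intro sum.cong refl) (simp add: tensor_vec_index [OF x y] mult_ac)

text \<open>The inner product conjugates both factors of the product vector. For x this is done by
  the outer inner product, for y it has to be done explicitly.\<close>

lemma unvec_overlap:
  assumes x: "x \<in> carrier_vec m" and y: "y \<in> carrier_vec n"
  shows "(unvec m n \<phi> *\<^sub>v conjugate y) \<bullet>c x = \<phi> \<bullet>c tensor_vec x y"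
proof -
  have "(unvec m n \<phi> *\<^sub>v conjugate y) \<bullet>c x = (\<Sum>i<m. (\<Sum>j<n. \<phi> $ (i * n + j) * cnj (y $ j)) * cnj (x $ i))"
    unfolding cscalar_sum [OF x] using x y
    by (intro sum.cong refl) (simp add: mult_mat_vec_sum [of _ m n] del: index_mult_mat_vec)
  also have "\<dots> = \<phi> \<bullet>c tensor_vec x y"
    unfolding overlap_tensor_vec [OF x y] by (simp add: sum_distrib_left sum_distrib_right mult_ac)
  finally show ?thesis .
qed

definition vec_sum :: "nat \<Rightarrow> complex vec list \<Rightarrow> complex vec" where
  "vec_sum n vs = vec n (\<lambda>i. \<Sum>v\<leftarrow>vs. v $ i)"

lemma vec_sum_carrier [simp]: "vec_sum n vs \<in> carrier_vec n"
  by (simp add: vec_sum_def)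

lemma cnj_sum_list: "cnj (sum_list xs) = sum_list (map cnj xs)"
  by (induction xs) simp_all

text \<open>Only the diagonal of the double sum of inner products survives. Dividing by the square
  root of n therefore gives a unit vector, the |s_1> of the basis.\<close>

lemma norm_sq_vec_sum_orthonormal_basis:
  assumes "orthonormal_basis n bs"
  shows "norm_sq (vec_sum n bs) = real n"
proof -
  have len: "length bs = n" and c: "\<And>i. i < n \<Longrightarrow> bs ! i \<in> carrier_vec n"
    and o: "\<And>i j. i < n \<Longrightarrow> j < n \<Longrightarrow> bs ! i \<bullet>c bs ! j = (if i = j then 1 else 0)"
    using assms by (auto simp: orthonormal_basis_def)
  have s: "vec_sum n bs $ k = (\<Sum>i<n. bs ! i $ k)" if "k < n" for k
    using that len by (simp add: vec_sum_def sum_list_sum_nth lessThan_atLeast0)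
  have "complex_of_real (norm_sq (vec_sum n bs)) =
      (\<Sum>k<n. (\<Sum>i<n. bs ! i $ k) * cnj (\<Sum>j<n. bs ! j $ k))"
    unfolding cscalar_self [symmetric] cscalar_sum [OF vec_sum_carrier]
    by (intro sum.cong refl) (simp add: s)
  also have "\<dots> = (\<Sum>k<n. \<Sum>i<n. \<Sum>j<n. bs ! i $ k * cnj (bs ! j $ k))"
    by (simp add: sum_product)
  also have "\<dots> = (\<Sum>i<n. \<Sum>k<n. \<Sum>j<n. bs ! i $ k * cnj (bs ! j $ k))"
    by (rule sum.swap)
  also have "\<dots> = (\<Sum>i<n. \<Sum>j<n. \<Sum>k<n. bs ! i $ k * cnj (bs ! j $ k))"
    by (intro sum.cong refl sum.swap)
  also have "\<dots> = (\<Sum>i<n. \<Sum>j<n. bs ! i \<bullet>c bs ! j)"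
    by (intro sum.cong refl) (simp add: cscalar_sum [OF c])
  also have "\<dots> = (\<Sum>i<n. \<Sum>j<n. if i = j then 1 else 0)"
    by (intro sum.cong refl) (simp add: o)
  also have "\<dots> = complex_of_real (real n)"
    by simp
  finally show ?thesis by (simp only: of_real_eq_iff)
qed

section \<open>Texture in product bases\<close>

lemma texture_norm:
  assumes \<psi>: "\<psi> \<in> carrier_vec n" and bs: "set bs \<subseteq> carrier_vec n"
  shows "texture bs \<psi> = 1 - (cmod (\<Sum>b\<leftarrow>bs. \<psi> \<bullet>c b))\<^sup>2 / real (length bs)"
proof -
  have c: "bs ! j \<bullet>c \<psi> = cnj (\<psi> \<bullet>c bs ! j)" if "j < length bs" for j
  proof -
    have "bs ! j \<in> carrier_vec n" using bs that by auto
    then show ?thesis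
      by (simp add: cscalar_sum [OF \<psi>] cscalar_sum [of "bs ! j" n] mult.commute)
  qed
  have "(\<Sum>i<length bs. \<Sum>j<length bs. (\<psi> \<bullet>c bs ! i) * (bs ! j \<bullet>c \<psi>)) =
      (\<Sum>i<length bs. \<Sum>j<length bs. (\<psi> \<bullet>c bs ! i) * cnj (\<psi> \<bullet>c bs ! j))"
    by (intro sum.cong refl) (simp only: c lessThan_iff)
  also have "\<dots> = (\<Sum>i<length bs. \<psi> \<bullet>c bs ! i) * cnj (\<Sum>i<length bs. \<psi> \<bullet>c bs ! i)"
    by (simp only: cnj_sum sum_product)
  also have "(\<Sum>i<length bs. \<psi> \<bullet>c bs ! i) = (\<Sum>b\<leftarrow>bs. \<psi> \<bullet>c b)"
    by (simp add: sum_list_sum_nth lessThan_atLeast0)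
  finally show ?thesis
    unfolding texture_def complex_norm_square [symmetric] by (simp only: Re_complex_of_real)
qed

text \<open>The sum over a product basis factors, so its distinguished vector |s_1> is the product
  of the two local ones. This is why textures in product bases measure overlaps with product
  vectors.\<close>

lemma sum_list_overlap_product_basis:
  assumes as: "set as \<subseteq> carrier_vec m" and bs: "set bs \<subseteq> carrier_vec n"
  shows "(\<Sum>b\<leftarrow>product_basis as bs. \<phi> \<bullet>c b) = \<phi> \<bullet>c tensor_vec (vec_sum m as) (vec_sum n bs)"
proof -
  have "(\<Sum>b\<leftarrow>product_basis as bs. \<phi> \<bullet>c b) = (\<Sum>a\<leftarrow>as. \<Sum>b\<leftarrow>bs. \<phi> \<bullet>c tensor_vec a b)"
    by (simp add: product_basis_def sum_list_map_concat o_def)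
  also have "\<dots> = (\<Sum>a\<leftarrow>as. \<Sum>b\<leftarrow>bs. \<Sum>i<m. \<Sum>j<n. \<phi> $ (i * n + j) * cnj (a $ i) * cnj (b $ j))"
    using as bs
    by (intro arg_cong [of _ _ sum_list] map_cong refl overlap_tensor_vec) auto
  also have "\<dots> = (\<Sum>i<m. \<Sum>j<n. \<Sum>a\<leftarrow>as. \<Sum>b\<leftarrow>bs. \<phi> $ (i * n + j) * cnj (a $ i) * cnj (b $ j))"
    by (simp add: sum_list_sum_swap)
  also have "\<dots> = (\<Sum>i<m. \<Sum>j<n. \<phi> $ (i * n + j) * (\<Sum>a\<leftarrow>as. cnj (a $ i)) * (\<Sum>b\<leftarrow>bs. cnj (b $ j)))"
    by (simp add: sum_list_const_mult sum_list_mult_const)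
  also have "\<dots> = \<phi> \<bullet>c tensor_vec (vec_sum m as) (vec_sum n bs)"
    unfolding overlap_tensor_vec [OF vec_sum_carrier vec_sum_carrier]
    by (intro sum.cong refl) (simp add: vec_sum_def cnj_sum_list o_def)
  finally show ?thesis .
qed

lemma texture_product_basis:
  assumes as: "orthonormal_basis m as" and bs: "orthonormal_basis n bs"
    and \<psi>: "\<psi> \<in> carrier_vec (m * n)"
  shows "texture (product_basis as bs) \<psi> =
    1 - (cmod (\<psi> \<bullet>c tensor_vec (vec_sum m as) (vec_sum n bs)))\<^sup>2 / (real m * real n)"
proof -
  have c: "set as \<subseteq> carrier_vec m" "set bs \<subseteq> carrier_vec n" "length as = m" "length bs = n"
    using as bs by (auto simp: orthonormal_basis_def)
  have "set (product_basis as bs) \<subseteq> carrier_vec (m * n)"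
    using c by (auto simp: product_basis_def intro!: tensor_vec_carrier)
  moreover have "length (product_basis as bs) = m * n"
    unfolding product_basis_def using c(3,4) 
    by (simp add: length_concat o_def sum_list_triv)
  ultimately show ?thesis
    using texture_norm [OF \<psi>] sum_list_overlap_product_basis [OF c(1,2)] by simp
qed

text \<open>After a change of phase, \<open>a\<close> has a real inner product with the normalized sum \<open>s\<close> of the
  standard basis, so the Householder reflection along \<open>w = s - a\<close> maps \<open>s\<close> to \<open>a\<close>. It maps the
  standard basis to the basis sought. For \<open>w = 0\<close> the convention \<open>x / 0 = 0\<close> makes it the
  identity.\<close>

lemma orthonormal_basis_with_sum:
  assumes a: "pure_state n a" and n: "0 < n"
  obtains bs c where "orthonormal_basis n bs" "cmod c = 1"
    "vec_sum n bs = (c * complex_of_real (sqrt (real n))) \<cdot>\<^sub>v a"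
proof -
  define r where "r = complex_of_real (1 / sqrt (real n))"
  define z where "z = (\<Sum>k<n. a $ k * r)"
  \<comment> \<open>The phase for which c z is real and nonnegative, z being the overlap of a with
    the normalized sum of the standard basis. If z = 0, every phase qualifies.\<close>
  define c where "c = (if z = 0 then 1 else cnj z / cmod z)"
  define w where "w k = r - c * a $ k" for k
  define W where "W = (\<Sum>k<n. w k * cnj (w k))"
  define u where "u j = vec n (\<lambda>k. (if k = j then 1 else 0) - 2 / W * w k * cnj (w j))" for j
  define bs where "bs = map u [0..<n]"
  have ac: "a \<in> carrier_vec n" and a1: "(\<Sum>k<n. a $ k * cnj (a $ k)) = 1"
    using a cscalar_sum [of a n a] by (auto simp: pure_state_def)
  have c1: "cmod c = 1" by (simp add: c_def norm_divide)
  have cc: "c * cnj c = 1" using c1 by (simp add: complex_norm_square [symmetric])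
  have cz: "c * z = complex_of_real (cmod z)"
    by (simp add: c_def complex_norm_square [symmetric] power2_eq_square mult.commute [of "cnj z"])
  have rn: "r * r * of_nat n = 1"
    using n by (simp add: r_def power2_eq_square [symmetric] power_divide)
      (simp add: of_real_power [symmetric] del: of_real_power)
  have cr: "cnj r = r" by (simp add: r_def)
  \<comment> \<open>W is the squared distance of two unit vectors whose inner product c z is
    real.\<close>
  have W: "W = 2 * (1 - c * z)"
  proof -
    have "W = (\<Sum>k<n. r * r - c * (a $ k * r) - cnj (c * (a $ k * r)) + c * cnj c * (a $ k * cnj (a $ k)))"
      unfolding W_def w_def by (intro sum.cong refl) (simp add: algebra_simps cr)
    also have "\<dots> = of_nat n * (r * r) - c * z - cnj (c * z) + c * cnj c * (\<Sum>k<n. a $ k * cnj (a $ k))"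
      by (simp add: sum.distrib sum_subtractf sum_distrib_left z_def)
    also have "\<dots> = 2 * (1 - c * z)"
      using rn by (simp add: cz cc a1 algebra_simps)
    finally show ?thesis .
  qed
  have W0: "w k = 0" if "W = 0" "k < n" for k
  proof -
    have "complex_of_real (\<Sum>k<n. (cmod (w k))\<^sup>2) = 0"
      using that(1) by (simp only: W_def complex_norm_square [symmetric] of_real_sum)
    then have "(\<Sum>k<n. (cmod (w k))\<^sup>2) = 0" by (simp only: of_real_eq_0_iff)
    with that(2) show ?thesis by (simp add: sum_nonneg_eq_0_iff)
  qed
  have cW: "cnj W = W" by (simp add: W_def mult.commute)
  have scaled: "(\<Sum>k<n. C * (w k * cnj (w k))) = C * W" for C
    by (simp only: W_def sum_distrib_left)
  have "u i \<bullet>c u j = (if i = j then 1 else 0)" if "i < n" "j < n" for i j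
  proof -
    have "u i \<bullet>c u j = (\<Sum>k<n. ((if k = i then 1 else 0) - 2 / W * w k * cnj (w i)) *
        ((if k = j then 1 else 0) - 2 / W * cnj (w k) * w j))"
      by (subst cscalar_sum [of _ n]) (auto simp: u_def cW intro!: sum.cong)
    also have "\<dots> = (\<Sum>k<n. (if k = i then if i = j then 1 else 0 else 0)
        - (if k = i then 2 / W * cnj (w i) * w j else 0)
        - (if k = j then 2 / W * w j * cnj (w i) else 0)
        + 2 / W * (2 / W) * cnj (w i) * w j * (w k * cnj (w k)))"
      by (intro sum.cong refl) (simp add: algebra_simps)
    also have "\<dots> = (if i = j then 1 else 0) - 2 / W * cnj (w i) * w j - 2 / W * w j * cnj (w i)
        + 2 / W * (2 / W) * cnj (w i) * w j * W"
      unfolding sum.distrib sum_subtractf scaled using that by simp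
    also have "\<dots> = (if i = j then 1 else 0)"
      by (cases "W = 0") (simp_all add: field_simps)
    finally show ?thesis .
  qed
  then have "orthonormal_basis n bs"
    by (auto simp: orthonormal_basis_def bs_def u_def)
  moreover have "vec_sum n bs = (c * complex_of_real (sqrt (real n))) \<cdot>\<^sub>v a"
  proof (rule eq_vecI)
    fix k assume "k < dim_vec ((c * complex_of_real (sqrt (real n))) \<cdot>\<^sub>v a)"
    then have k: "k < n" using ac by simp
    have rs: "r * complex_of_real (sqrt (real n)) = 1"
      using n by (simp add: r_def flip: of_real_mult)
    have "vec_sum n bs $ k = (\<Sum>j<n. u j $ k)"
      using k by (simp add: vec_sum_def bs_def sum_list_sum_nth lessThan_atLeast0)
    also have "\<dots> = (\<Sum>j<n. (if k = j then 1 else 0) - 2 / W * w k * cnj (w j))"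
      using k by (simp add: u_def)
    also have "\<dots> = 1 - 2 / W * w k * (\<Sum>j<n. cnj (w j))"
      using k by (simp add: sum_subtractf sum_distrib_left)
    \<comment> \<open>Up to the factor sqrt n, the left side is the inner product of w with the
      normalized sum of the standard basis, which is 1 - c z = W / 2. The factor 2 / W of the
      reflection then cancels, and exactly w is subtracted.\<close>
    also have "(\<Sum>j<n. cnj (w j)) = complex_of_real (sqrt (real n)) * (W / 2)"
    proof -
      have "r * (\<Sum>j<n. cnj (w j)) = cnj (\<Sum>j<n. r * r - c * (a $ j * r))"
        by (simp add: w_def cr sum_distrib_left algebra_simps)
      also have "\<dots> = 1 - c * z"
        using rn by (simp add: sum_subtractf sum_distrib_left [symmetric] z_def [symmetric] cr cz mult.commute [of "of_nat n"])
      finally have "complex_of_real (sqrt (real n)) * (r * (\<Sum>j<n. cnj (w j))) =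
          complex_of_real (sqrt (real n)) * (W / 2)"
        by (simp add: W)
      then show ?thesis using rs by (simp add: mult.assoc [symmetric] mult.commute [of _ r])
    qed
    also have "1 - 2 / W * w k * (complex_of_real (sqrt (real n)) * (W / 2)) =
        1 - w k * complex_of_real (sqrt (real n))"
      using W0 [OF _ k] by (cases "W = 0") simp_all
    also have "\<dots> = c * complex_of_real (sqrt (real n)) * a $ k"
      using rs by (simp add: w_def algebra_simps)
    finally show "vec_sum n bs $ k = ((c * complex_of_real (sqrt (real n))) \<cdot>\<^sub>v a) $ k"
      using k ac by simp
  qed (use ac in simp)
  ultimately show thesis using c1 that by blast
qed

lemma tensor_vec_smult:
  assumes "x \<in> carrier_vec m" "y \<in> carrier_vec n"
  shows "tensor_vec (c \<cdot>\<^sub>v x) (d \<cdot>\<^sub>v y) = (c * d) \<cdot>\<^sub>v tensor_vec x y"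
proof (rule eq_vecI)
  fix k assume "k < dim_vec ((c * d) \<cdot>\<^sub>v tensor_vec x y)"
  then have k: "k < m * n" using assms by (simp add: tensor_vec_def)
  then have "k div n < m" "k mod n < n"
    by (auto simp: less_mult_imp_div_less) (metis mod_less_divisor mult_0_right neq0_conv not_less0)
  with k assms show "tensor_vec (c \<cdot>\<^sub>v x) (d \<cdot>\<^sub>v y) $ k = ((c * d) \<cdot>\<^sub>v tensor_vec x y) $ k"
    by (simp add: tensor_vec_def)
qed (simp add: tensor_vec_def)

lemma cscalar_smult_right:
  fixes v w :: "complex vec"
  assumes "v \<in> carrier_vec n" "w \<in> carrier_vec n"
  shows "v \<bullet>c (c \<cdot>\<^sub>v w) = cnj c * (v \<bullet>c w)"
  using assms by (simp add: cscalar_sum [of _ n] sum_distrib_left mult_ac)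

text \<open>The normalized sums of the two bases, the second one conjugated, are one of the pairs
  over which the supremum runs.\<close>

lemma texture_le_max_overlap:
  assumes "orthonormal_basis m as" "orthonormal_basis n bs" "\<psi> \<in> carrier_vec (m * n)" "0 < m" "0 < n"
  shows "1 - max_overlap (unvec m n \<psi>) \<le> texture (product_basis as bs) \<psi>"
proof -
  let ?S = "vec_sum m as" and ?T = "vec_sum n bs"
  let ?s = "complex_of_real (1 / sqrt (real m)) \<cdot>\<^sub>v ?S"
  let ?t = "complex_of_real (1 / sqrt (real n)) \<cdot>\<^sub>v ?T"
  have s: "pure_state m ?s" and t: "pure_state n ?t"
    using normalize_pure_state [of ?S m] normalize_pure_state [of ?T n] assms
    by (simp_all add: norm_sq_vec_sum_orthonormal_basis)
  have "(cmod (\<psi> \<bullet>c tensor_vec ?s ?t))\<^sup>2 \<le> max_overlap (unvec m n \<psi>)"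
    using max_overlap_upper [OF unvec_carrier s pure_state_conjugate [OF t], of \<psi>]
      unvec_overlap [of ?s m ?t n \<psi>] by simp
  moreover have "(cmod (\<psi> \<bullet>c tensor_vec ?s ?t))\<^sup>2 = (cmod (\<psi> \<bullet>c tensor_vec ?S ?T))\<^sup>2 / (real m * real n)"
    by (simp add: tensor_vec_smult [OF vec_sum_carrier vec_sum_carrier] norm_mult norm_divide
        cscalar_smult_right [OF assms(3) tensor_vec_carrier [OF vec_sum_carrier vec_sum_carrier]]
        power_divide power_mult_distrib)
  ultimately show ?thesis
    using texture_product_basis [OF assms(1-3)] by simp
qed

text \<open>Choose bases whose sums point along x and y. Their phases have modulus one, and the
  lengths sqrt m and sqrt n cancel against the normalization of the texture.\<close>

lemma texture_for_pure_states:
  assumes "pure_state m x" "pure_state n y" "\<psi> \<in> carrier_vec (m * n)" "0 < m" "0 < n"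
  obtains as bs where "orthonormal_basis m as" "orthonormal_basis n bs"
    "texture (product_basis as bs) \<psi> = 1 - (cmod (\<psi> \<bullet>c tensor_vec x y))\<^sup>2"
proof -
  obtain as c where as: "orthonormal_basis m as" "cmod c = 1"
    "vec_sum m as = (c * complex_of_real (sqrt (real m))) \<cdot>\<^sub>v x"
    using orthonormal_basis_with_sum [OF assms(1,4)] .
  obtain bs d where bs: "orthonormal_basis n bs" "cmod d = 1"
    "vec_sum n bs = (d * complex_of_real (sqrt (real n))) \<cdot>\<^sub>v y"
    using orthonormal_basis_with_sum [OF assms(2,5)] .
  have x: "x \<in> carrier_vec m" and y: "y \<in> carrier_vec n" using assms by (auto simp: pure_state_def)
  have "(cmod (\<psi> \<bullet>c tensor_vec (vec_sum m as) (vec_sum n bs)))\<^sup>2 =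
      (cmod (\<psi> \<bullet>c tensor_vec x y))\<^sup>2 * (real m * real n)"
    using as(2) bs(2)
    by (simp add: as(3) bs(3) tensor_vec_smult [OF x y] norm_mult
        cscalar_smult_right [OF assms(3) tensor_vec_carrier [OF x y]] power_mult_distrib)
  then have "texture (product_basis as bs) \<psi> = 1 - (cmod (\<psi> \<bullet>c tensor_vec x y))\<^sup>2"
    using texture_product_basis [OF as(1) bs(1) assms(3)] assms(4,5) by simp
  with as bs that show thesis by blast
qed

lemma pure_nonlocal_texture_eq:
  assumes \<psi>: "\<psi> \<in> carrier_vec (m * n)" and mn: "0 < m" "0 < n"
  shows "pure_nonlocal_texture m n \<psi> = 1 - max_overlap (unvec m n \<psi>)"
proof (rule antisym)
  let ?I = "{as. orthonormal_basis m as} \<times> {bs. orthonormal_basis n bs}"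
  have bdd: "bdd_below ((\<lambda>(as, bs). texture (product_basis as bs) \<psi>) ` ?I)"
    using texture_le_max_overlap [OF _ _ \<psi> mn] by (intro bdd_belowI [of _ "1 - max_overlap (unvec m n \<psi>)"]) auto
  have "max_overlap (unvec m n \<psi>) \<le> 1 - pure_nonlocal_texture m n \<psi>"
  proof (rule max_overlap_least [OF unvec_carrier mn])
    fix x y assume x: "pure_state m x" and y: "pure_state n y"
    note y' = pure_state_conjugate [OF y]
    obtain as bs where ab: "orthonormal_basis m as" "orthonormal_basis n bs"
      "texture (product_basis as bs) \<psi> = 1 - (cmod (\<psi> \<bullet>c tensor_vec x (conjugate y)))\<^sup>2"
      using texture_for_pure_states [OF x y' \<psi> mn] .
    have "pure_nonlocal_texture m n \<psi> \<le> (\<lambda>(as, bs). texture (product_basis as bs) \<psi>) (as, bs)"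
      unfolding pure_nonlocal_texture_def using ab by (intro cINF_lower bdd) auto
    moreover have "(unvec m n \<psi> *\<^sub>v y) \<bullet>c x = \<psi> \<bullet>c tensor_vec x (conjugate y)"
      using unvec_overlap [of x m "conjugate y" n \<psi>] x y by (simp add: pure_state_def)
    ultimately show "(cmod ((unvec m n \<psi> *\<^sub>v y) \<bullet>c x))\<^sup>2 \<le> 1 - pure_nonlocal_texture m n \<psi>"
      using ab by simp
  qed
  then show "pure_nonlocal_texture m n \<psi> \<le> 1 - max_overlap (unvec m n \<psi>)" by simp
  obtain x y where "pure_state m x" "pure_state n y" using mn by (meson pure_state_exists)
  then have "?I \<noteq> {}" using texture_for_pure_states [OF _ _ \<psi> mn] by blast
  then show "1 - max_overlap (unvec m n \<psi>) \<le> pure_nonlocal_texture m n \<psi>"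
    unfolding pure_nonlocal_texture_def
    using texture_le_max_overlap [OF _ _ \<psi> mn] by (intro cINF_greatest) auto
qed

section \<open>Ensembles of states and lists of unnormalized vectors\<close>

lemma unvec_smult:
  "\<phi> \<in> carrier_vec (m * n) \<Longrightarrow> unvec m n (c \<cdot>\<^sub>v \<phi>) = c \<cdot>\<^sub>m unvec m n \<phi>"
  by (intro eq_matI) (auto simp: unvec_def pair_index_less)

lemma vector_cost_smult:
  assumes "\<phi> \<in> carrier_vec (m * n)" "0 < m" "0 < n"
  shows "vector_cost m n (c \<cdot>\<^sub>v \<phi>) = (cmod c)\<^sup>2 * vector_cost m n \<phi>"
  using assms
  by (simp add: vector_cost_def unvec_smult norm_sq_smult max_overlap_smult [OF unvec_carrier] right_diff_distrib)

lemma vector_cost_nonneg: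
  assumes "\<phi> \<in> carrier_vec (m * n)" "0 < m" "0 < n"
  shows "0 \<le> vector_cost m n \<phi>"
  using max_overlap_le_frob_sq [OF unvec_carrier assms(2,3), of \<phi>] frob_sq_unvec [OF assms(1)]
  by (simp add: vector_cost_def)

lemma vector_cost_pure_state:
  assumes "pure_state (m * n) \<psi>" "0 < m" "0 < n"
  shows "vector_cost m n \<psi> = pure_nonlocal_texture m n \<psi>"
  using assms by (simp add: vector_cost_def pure_nonlocal_texture_eq pure_state_iff)

lemma ketbra_smult: "ketbra (c \<cdot>\<^sub>v v) = complex_of_real ((cmod c)\<^sup>2) \<cdot>\<^sub>m ketbra v"
  by (intro eq_matI) (auto simp: ketbra_def complex_norm_square simp del: of_real_power)

lemma pure_decomposition_to_vectors:
  assumes E: "pure_decomposition (m * n) \<rho> E" and mn: "0 < m" "0 < n"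
  obtains F where "vector_decomposition (m * n) \<rho> F"
    "(\<Sum>\<phi>\<leftarrow>F. vector_cost m n \<phi>) = (\<Sum>(p, \<psi>)\<leftarrow>E. p * pure_nonlocal_texture m n \<psi>)"
proof
  let ?f = "\<lambda>(p, \<psi>). complex_of_real (sqrt p) \<cdot>\<^sub>v \<psi>"
  let ?F = "map ?f E"
  have e: "0 \<le> p" "pure_state (m * n) \<psi>" "\<psi> \<in> carrier_vec (m * n)" if "(p, \<psi>) \<in> set E" for p \<psi>
    using E that by (auto simp: pure_decomposition_def pure_state_def)
  have 1: "set ?F \<subseteq> carrier_vec (m * n)" using e(3) by auto
  have 2: "(\<Sum>\<phi>\<leftarrow>?F. norm_sq \<phi>) = (\<Sum>(p, \<psi>)\<leftarrow>E. p)"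
    unfolding map_map using e(1,2)
    by (intro arg_cong [of _ _ sum_list] map_cong refl) (auto simp: norm_sq_smult pure_state_iff)
  have 3: "map ketbra ?F = [complex_of_real p \<cdot>\<^sub>m ketbra \<psi>. (p, \<psi>) \<leftarrow> E]"
    unfolding map_map using e(1) by (intro map_cong refl) (auto simp: ketbra_smult)
  show "vector_decomposition (m * n) \<rho> ?F"
    using E 1 2 3 unfolding vector_decomposition_def pure_decomposition_def by metis
  show "(\<Sum>\<phi>\<leftarrow>?F. vector_cost m n \<phi>) = (\<Sum>(p, \<psi>)\<leftarrow>E. p * pure_nonlocal_texture m n \<psi>)"
    unfolding map_map using e mn
    by (intro arg_cong [of _ _ sum_list] map_cong refl)
      (auto simp: vector_cost_smult vector_cost_pure_state)
qed

lemma mat_sum_cong_entries: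
  assumes "set Ms \<subseteq> carrier_mat r c" "set Ns \<subseteq> carrier_mat r c"
    and "\<And>i j. i < r \<Longrightarrow> j < c \<Longrightarrow> (\<Sum>M\<leftarrow>Ms. M $$ (i, j)) = (\<Sum>M\<leftarrow>Ns. M $$ (i, j))"
  shows "mat_sum r c Ms = mat_sum r c Ns"
  using assms mat_sum_carrier [OF assms(1)] mat_sum_carrier [OF assms(2)]
  by (intro eq_matI) (auto simp: mat_sum_index)

text \<open>The squared norms become the probabilities. Zero vectors have no direction to normalize
  and are dropped; they contribute neither to the matrix nor to the cost.\<close>

lemma vectors_to_pure_decomposition:
  assumes F: "vector_decomposition (m * n) \<rho> F" and mn: "0 < m" "0 < n"
  obtains E where "pure_decomposition (m * n) \<rho> E"
    "(\<Sum>(p, \<psi>)\<leftarrow>E. p * pure_nonlocal_texture m n \<psi>) = (\<Sum>\<phi>\<leftarrow>F. vector_cost m n \<phi>)"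
proof
  let ?c = "\<lambda>\<phi>. complex_of_real (1 / sqrt (norm_sq \<phi>))"
  let ?G = "filter (\<lambda>\<phi>. norm_sq \<phi> \<noteq> 0) F"
  let ?E = "map (\<lambda>\<phi>. (norm_sq \<phi>, ?c \<phi> \<cdot>\<^sub>v \<phi>)) ?G"
  have Fc: "\<And>\<phi>. \<phi> \<in> set F \<Longrightarrow> \<phi> \<in> carrier_vec (m * n)"
    and \<rho>: "\<rho> = mat_sum (m * n) (m * n) (map ketbra F)" and one: "(\<Sum>\<phi>\<leftarrow>F. norm_sq \<phi>) = 1"
    using F by (auto simp: vector_decomposition_def)
  have pure: "pure_state (m * n) (?c \<phi> \<cdot>\<^sub>v \<phi>)" if "\<phi> \<in> set ?G" for \<phi>
    using that Fc by (intro normalize_pure_state) auto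
  have zero: "\<phi> = 0 \<cdot>\<^sub>v \<phi>" if "norm_sq \<phi> = 0" for \<phi>
    using that by (intro eq_vecI) (auto simp: norm_sq_def sum_nonneg_eq_0_iff)
  have "(\<Sum>(p, \<psi>)\<leftarrow>?E. p) = (\<Sum>\<phi>\<leftarrow>?G. norm_sq \<phi>)"
    by (simp add: o_def)
  also have "\<dots> = 1" using one by (subst sum_list_map_filter) auto
  finally have sum1: "(\<Sum>(p, \<psi>)\<leftarrow>?E. p) = 1" .
  have kb: "[complex_of_real p \<cdot>\<^sub>m ketbra \<psi>. (p, \<psi>) \<leftarrow> ?E] = map ketbra ?G"
    unfolding map_map
  proof (intro map_cong refl)
    fix \<phi> assume "\<phi> \<in> set ?G"
    then have "complex_of_real (norm_sq \<phi>) \<cdot>\<^sub>m (complex_of_real ((cmod (?c \<phi>))\<^sup>2) \<cdot>\<^sub>m ketbra \<phi>) = ketbra \<phi>"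
      by (intro eq_matI) (auto simp: norm_divide power_divide ketbra_def)
    then show "((\<lambda>(p, \<psi>). complex_of_real p \<cdot>\<^sub>m ketbra \<psi>) \<circ> (\<lambda>\<phi>. (norm_sq \<phi>, ?c \<phi> \<cdot>\<^sub>v \<phi>))) \<phi> = ketbra \<phi>"
      unfolding o_apply prod.case ketbra_smult .
  qed
  have "mat_sum (m * n) (m * n) (map ketbra ?G) = \<rho>"
    unfolding \<rho>
  proof (rule mat_sum_cong_entries)
    fix i j assume ij: "i < m * n" "j < m * n"
    have "ketbra \<phi> $$ (i, j) = 0" if "\<phi> \<in> set F" "\<not> norm_sq \<phi> \<noteq> 0" for \<phi>
    proof -
      have "\<phi> $ i = (0 \<cdot>\<^sub>v \<phi>) $ i" using zero that by metis
      then show ?thesis using Fc [OF that(1)] ij by (simp add: ketbra_def)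
    qed
    then show "(\<Sum>M\<leftarrow>map ketbra ?G. M $$ (i, j)) = (\<Sum>M\<leftarrow>map ketbra F. M $$ (i, j))"
      unfolding map_map by (intro sum_list_map_filter) simp
  qed (use Fc in \<open>auto intro!: ketbra_carrier\<close>)
  with sum1 pure show "pure_decomposition (m * n) \<rho> ?E"
    unfolding pure_decomposition_def kb by auto
  have "(\<Sum>(p, \<psi>)\<leftarrow>?E. p * pure_nonlocal_texture m n \<psi>) = (\<Sum>\<phi>\<leftarrow>?G. vector_cost m n \<phi>)"
    unfolding map_map
  proof (intro arg_cong [of _ _ sum_list] map_cong refl)
    fix \<phi> assume G: "\<phi> \<in> set ?G"
    have "vector_cost m n (?c \<phi> \<cdot>\<^sub>v \<phi>) = (cmod (?c \<phi>))\<^sup>2 * vector_cost m n \<phi>"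
      using G Fc mn by (intro vector_cost_smult) auto
    then have "norm_sq \<phi> * pure_nonlocal_texture m n (?c \<phi> \<cdot>\<^sub>v \<phi>) = vector_cost m n \<phi>"
      using G vector_cost_pure_state [OF pure [OF G] mn] by (simp add: norm_divide power_divide field_simps)
    then show "((\<lambda>(p, \<psi>). p * pure_nonlocal_texture m n \<psi>) \<circ> (\<lambda>\<phi>. (norm_sq \<phi>, ?c \<phi> \<cdot>\<^sub>v \<phi>))) \<phi> =
        vector_cost m n \<phi>"
      by simp
  qed
  also have "\<dots> = (\<Sum>\<phi>\<leftarrow>F. vector_cost m n \<phi>)"
  proof (rule sum_list_map_filter)
    fix \<phi> assume \<phi>: "\<phi> \<in> set F" "\<not> norm_sq \<phi> \<noteq> 0"
    have "vector_cost m n (0 \<cdot>\<^sub>v \<phi>) = 0" using vector_cost_smult [OF Fc [OF \<phi>(1)] mn, of 0] by simp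
    then show "vector_cost m n \<phi> = 0" using zero \<phi> by metis
  qed
  finally show "(\<Sum>(p, \<psi>)\<leftarrow>?E. p * pure_nonlocal_texture m n \<psi>) = (\<Sum>\<phi>\<leftarrow>F. vector_cost m n \<phi>)" .
qed

lemma vector_costs_nonneg:
  "vector_decomposition (m * n) \<rho> F \<Longrightarrow> 0 < m \<Longrightarrow> 0 < n \<Longrightarrow> 0 \<le> (\<Sum>\<phi>\<leftarrow>F. vector_cost m n \<phi>)"
  by (intro sum_list_nonneg) (auto simp: vector_decomposition_def intro!: vector_cost_nonneg)

text \<open>The two index sets yield the same set of values, so the equation holds for every \<rho>,
  even if both sets are empty.\<close>

lemma nonlocal_texture_eq:
  assumes mn: "0 < m" "0 < n"
  shows "nonlocal_texture m n \<rho> =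
    (INF F \<in> {F. vector_decomposition (m * n) \<rho> F}. \<Sum>\<phi>\<leftarrow>F. vector_cost m n \<phi>)"
  unfolding nonlocal_texture_def
proof (rule arg_cong [of _ _ Inf], intro equalityI image_subsetI)
  fix E assume "E \<in> {E. pure_decomposition (m * n) \<rho> E}"
  then have "pure_decomposition (m * n) \<rho> E" by simp
  from pure_decomposition_to_vectors [OF this mn]
  obtain F where F: "vector_decomposition (m * n) \<rho> F"
    "(\<Sum>\<phi>\<leftarrow>F. vector_cost m n \<phi>) = (\<Sum>(p, \<psi>)\<leftarrow>E. p * pure_nonlocal_texture m n \<psi>)" .
  show "(\<Sum>(p, \<psi>)\<leftarrow>E. p * pure_nonlocal_texture m n \<psi>)
      \<in> (\<lambda>F. \<Sum>\<phi>\<leftarrow>F. vector_cost m n \<phi>) ` {F. vector_decomposition (m * n) \<rho> F}"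
    unfolding F(2) [symmetric] using F(1) by (intro imageI) simp
next
  fix F assume "F \<in> {F. vector_decomposition (m * n) \<rho> F}"
  then have "vector_decomposition (m * n) \<rho> F" by simp
  from vectors_to_pure_decomposition [OF this mn]
  obtain E where E: "pure_decomposition (m * n) \<rho> E"
    "(\<Sum>(p, \<psi>)\<leftarrow>E. p * pure_nonlocal_texture m n \<psi>) = (\<Sum>\<phi>\<leftarrow>F. vector_cost m n \<phi>)" .
  show "(\<Sum>\<phi>\<leftarrow>F. vector_cost m n \<phi>)
      \<in> (\<lambda>E. \<Sum>(p, \<psi>)\<leftarrow>E. p * pure_nonlocal_texture m n \<psi>) ` {E. pure_decomposition (m * n) \<rho> E}"
    unfolding E(2) [symmetric] using E(1) by (intro imageI) simp
qed

lemma nonlocal_texture_le: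
  assumes "vector_decomposition (m * n) \<rho> F" and mn: "0 < m" "0 < n"
  shows "nonlocal_texture m n \<rho> \<le> (\<Sum>\<phi>\<leftarrow>F. vector_cost m n \<phi>)"
  unfolding nonlocal_texture_eq [OF mn]
  using assms vector_costs_nonneg [OF _ mn] by (intro cINF_lower bdd_belowI [of _ 0]) auto

subsection \<open>Existence of decompositions\<close>

text \<open>The form <w|\<rho> v>, linear in v and conjugate linear in w. Functions in place of
  vectors avoid carrier conditions; only their values below n matter.\<close>

definition sesq :: "nat \<Rightarrow> complex mat \<Rightarrow> (nat \<Rightarrow> complex) \<Rightarrow> (nat \<Rightarrow> complex) \<Rightarrow> complex" where
  "sesq n \<rho> v w = (\<Sum>a<n. \<Sum>b<n. \<rho> $$ (a, b) * v b * cnj (w a))"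

lemma sesq_add_scaled:
  "sesq n \<rho> (\<lambda>b. v b + t * u b) (\<lambda>b. v b + t * u b) =
    sesq n \<rho> v v + t * sesq n \<rho> u v + cnj t * sesq n \<rho> v u + t * cnj t * sesq n \<rho> u u"
  unfolding sesq_def sum_distrib_left sum.distrib [symmetric]
  by (intro sum.cong refl) (simp add: algebra_simps)

lemma sum_mult_indicator:
  fixes f :: "nat \<Rightarrow> complex"
  assumes "i < n"
  shows "(\<Sum>a<n. f a * (if a = i then 1 else 0)) = f i"
    and "(\<Sum>a<n. f a * cnj (if a = i then 1 else 0)) = f i"
proof -
  have "f a * (if a = i then 1 else 0) = (if a = i then f a else 0)"
    "f a * cnj (if a = i then 1 else 0) = (if a = i then f a else 0)" for a
    by simp_all
  then show "(\<Sum>a<n. f a * (if a = i then 1 else 0)) = f i"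
    "(\<Sum>a<n. f a * cnj (if a = i then 1 else 0)) = f i"
    using assms by simp_all
qed

lemma sesq_unit:
  assumes i: "i < n"
  shows "sesq n \<rho> (\<lambda>b. if b = i then 1 else 0) w = (\<Sum>a<n. \<rho> $$ (a, i) * cnj (w a))"
    and "sesq n \<rho> v (\<lambda>a. if a = i then 1 else 0) = (\<Sum>b<n. \<rho> $$ (i, b) * v b)"
proof -
  show "sesq n \<rho> (\<lambda>b. if b = i then 1 else 0) w = (\<Sum>a<n. \<rho> $$ (a, i) * cnj (w a))"
    unfolding sesq_def sum_distrib_right [symmetric] sum_mult_indicator [OF i] ..
  show "sesq n \<rho> v (\<lambda>a. if a = i then 1 else 0) = (\<Sum>b<n. \<rho> $$ (i, b) * v b)"
    unfolding sesq_def sum_distrib_right [symmetric] sum_mult_indicator [OF i] ..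
qed

text \<open>Polarization: the form is real on the diagonal, and reality at v + u and at v + \<i> u
  gives the imaginary and the real part of the claim.\<close>

lemma sesq_hermitian:
  assumes pos: "\<And>v. 0 \<le> sesq n \<rho> v v"
  shows "sesq n \<rho> u v = cnj (sesq n \<rho> v u)"
proof -
  have "Im (sesq n \<rho> w w) = 0" for w using pos [of w] by (simp add: less_eq_complex_def)
  note r = this [of u] this [of v] this [of "\<lambda>b. v b + 1 * u b"] this [of "\<lambda>b. v b + \<i> * u b"]
  show ?thesis
    using r unfolding sesq_add_scaled by (intro complex_eqI) auto
qed

text \<open>If the form vanishes at u, then its value at v + t u has no quadratic term in t. A
  nonzero cross term could then be made to dominate with a suitable t, giving a negative
  value.\<close>

lemma sesq_zero:
  assumes pos: "\<And>v. 0 \<le> sesq n \<rho> v v" and "sesq n \<rho> u u = 0"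
  shows "sesq n \<rho> u v = 0"
proof (rule ccontr)
  let ?z = "sesq n \<rho> u v"
  assume z: "?z \<noteq> 0"
  \<comment> \<open>Chosen so that the cross terms exceed the value at v by exactly 1.\<close>
  define s where "s = (Re (sesq n \<rho> v v) + 1) / (2 * (cmod ?z)\<^sup>2)"
  define t where "t = - (complex_of_real s * cnj ?z)"
  have h: "sesq n \<rho> v u = cnj ?z" by (rule sesq_hermitian [OF pos])
  have "0 \<le> sesq n \<rho> (\<lambda>b. v b + t * u b) (\<lambda>b. v b + t * u b)" by (rule pos)
  then have "0 \<le> Re (sesq n \<rho> v v) + Re (t * ?z) + Re (cnj t * cnj ?z)"
    unfolding sesq_add_scaled h assms(2) less_eq_complex_def by simp
  also have "t * ?z = - complex_of_real (s * (cmod ?z)\<^sup>2)"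
    by (simp add: t_def complex_norm_square mult_ac del: of_real_power)
  also have "cnj t * cnj ?z = - complex_of_real (s * (cmod ?z)\<^sup>2)"
    by (simp add: t_def complex_norm_square mult_ac del: of_real_power)
  finally have "2 * (s * (cmod ?z)\<^sup>2) \<le> Re (sesq n \<rho> v v)" by simp
  moreover have "2 * (s * (cmod ?z)\<^sup>2) = Re (sesq n \<rho> v v) + 1"
    using z by (simp add: s_def)
  ultimately show False by simp
qed

text \<open>Cholesky factorization: the Schur complement of a positive diagonal entry is again positive
  semidefinite and has one more vanishing row and column.\<close>

lemma psd_ketbra_sum:
  assumes "\<rho> \<in> carrier_mat n n" "\<And>v. 0 \<le> sesq n \<rho> v v"
    and "k \<le> n" "\<And>i j. i < n \<Longrightarrow> j < n \<Longrightarrow> i < k \<or> j < k \<Longrightarrow> \<rho> $$ (i, j) = 0"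
  shows "\<exists>F. set F \<subseteq> carrier_vec n \<and> \<rho> = mat_sum n n (map ketbra F)"
  \<comment> \<open>The induction descends from k = n, where the matrix is zero; k counts the
    leading rows and columns that already vanish.\<close>
  using assms(3,1,2,4)
proof (induction arbitrary: \<rho> rule: inc_induct)
  case base
  then have "\<rho> = 0\<^sub>m n n" by (intro eq_matI) auto
  then show ?case by (intro exI [of _ "[]"]) (simp add: mat_sum_def)
next
  case (step k)
  note \<rho> = step.prems(1) and pos = step.prems(2) and k = \<open>k < n\<close>
  let ?e = "\<lambda>b. if b = k then 1 else 0 :: complex"
  let ?d = "\<rho> $$ (k, k)"
  have dk: "sesq n \<rho> ?e ?e = ?d"
    unfolding sesq_unit(2) [OF k] sum_mult_indicator [OF k] ..
  have herm: "\<rho> $$ (i, j) = cnj (\<rho> $$ (j, i))" if "i < n" "j < n" for i j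
    using sesq_hermitian [OF pos, of "\<lambda>b. if b = j then 1 else 0" "\<lambda>b. if b = i then 1 else 0"] that
    by (simp only: sesq_unit(2) sum_mult_indicator)
  have d: "0 \<le> Re ?d" "?d = complex_of_real (Re ?d)"
    using pos [of ?e] unfolding dk by (auto simp: less_eq_complex_def complex_eq_iff)
  \<comment> \<open>Column k divided by the root of the pivot. For a zero pivot, x / 0 = 0 gives the
    zero vector, as it should: the column itself vanishes by \<open>sesq_zero\<close>.\<close>
  define c where "c = vec n (\<lambda>a. \<rho> $$ (a, k) / complex_of_real (sqrt (Re ?d)))"
  have c: "c \<in> carrier_vec n" by (simp add: c_def)
  have zero: "\<rho> $$ (a, k) = 0" if "?d = 0" "a < n" for a
    using sesq_zero [OF pos, of ?e "\<lambda>b. if b = a then 1 else 0"] that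
    unfolding dk sesq_unit(2) [OF that(2)] sum_mult_indicator [OF k] by simp
  have kb: "ketbra c $$ (a, b) = \<rho> $$ (a, k) * \<rho> $$ (k, b) / ?d" if "a < n" "b < n" for a b
  proof -
    have "complex_of_real (sqrt (Re ?d)) * complex_of_real (sqrt (Re ?d)) = ?d"
      using d by (metis of_real_mult real_sqrt_mult_self abs_of_nonneg)
    with that herm [OF k that(2)] show ?thesis by (simp add: ketbra_def c_def)
  qed
  define \<sigma> where "\<sigma> = \<rho> - ketbra c"
  have \<sigma>c: "\<sigma> \<in> carrier_mat n n" using \<rho> c by (simp add: \<sigma>_def minus_carrier_mat)
  have \<sigma>: "\<sigma> $$ (a, b) = \<rho> $$ (a, b) - \<rho> $$ (a, k) * \<rho> $$ (k, b) / ?d" if "a < n" "b < n" for a b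
    using that \<rho> c kb by (simp add: \<sigma>_def ketbra_def)
  have pos': "0 \<le> sesq n \<sigma> v v" for v
  proof -
    let ?L = "sesq n \<rho> v ?e" and ?R = "sesq n \<rho> ?e v"
    have L: "cnj ?L = ?R" using sesq_hermitian [OF pos] by metis
    have "sesq n \<sigma> v v = (\<Sum>a<n. \<Sum>b<n. \<rho> $$ (a, b) * v b * cnj (v a)
        - (\<rho> $$ (a, k) * cnj (v a)) * (\<rho> $$ (k, b) * v b) / ?d)"
      unfolding sesq_def by (intro sum.cong refl) (simp add: \<sigma> algebra_simps)
    also have "\<dots> = sesq n \<rho> v v - ?R * ?L / ?d"
      unfolding sesq_unit [OF k] sum_product sum_divide_distrib by (simp add: sum_subtractf sesq_def)
    \<comment> \<open>Completing the square: the form of the Schur complement at v is that of \<rho>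
      at v shifted along the k-th unit vector, with the shift that minimizes the latter for a
      positive pivot.\<close>
    also have "\<dots> = sesq n \<rho> (\<lambda>b. v b + (- ?L / ?d) * ?e b) (\<lambda>b. v b + (- ?L / ?d) * ?e b)"
    proof (cases "?d = 0")
      case True
      then show ?thesis unfolding sesq_add_scaled by simp
    next
      case False
      have "cnj ?d = ?d" using herm [OF k k] by simp
      then show ?thesis
        unfolding sesq_add_scaled dk using False L by (simp add: field_simps)
    qed
    finally show ?thesis using pos by simp
  qed
  have "\<exists>F. set F \<subseteq> carrier_vec n \<and> \<sigma> = mat_sum n n (map ketbra F)"
  proof (rule step.IH [OF \<sigma>c pos'])
    fix i j assume ij: "i < n" "j < n" "i < Suc k \<or> j < Suc k"
    show "\<sigma> $$ (i, j) = 0"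
    proof (cases "i < k \<or> j < k")
      case True
      then show ?thesis using step.prems(3) ij k by (auto simp: \<sigma>)
    next
      case False
      with ij have "i = k \<or> j = k" by auto
      moreover have "\<rho> $$ (a, k) = 0 \<and> \<rho> $$ (k, a) = 0" if "?d = 0" "a < n" for a
        using zero [OF that] herm [OF k that(2)] by simp
      ultimately show ?thesis
        using ij k by (cases "?d = 0") (auto simp: \<sigma>)
    qed
  qed
  then obtain F where F: "set F \<subseteq> carrier_vec n" "\<sigma> = mat_sum n n (map ketbra F)" by blast
  have "\<rho> = ketbra c + \<sigma>"
    using \<rho> c by (intro eq_matI) (auto simp: \<sigma>_def ketbra_def)
  with F c show ?case
    by (intro exI [of _ "c # F"]) (simp add: mat_sum_Cons)
qed

lemma trace_ketbra_sum:
  assumes "set F \<subseteq> carrier_vec n"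
  shows "(\<Sum>i<n. mat_sum n n (map ketbra F) $$ (i, i)) = complex_of_real (\<Sum>\<phi>\<leftarrow>F. norm_sq \<phi>)"
proof -
  have "(\<Sum>i<n. mat_sum n n (map ketbra F) $$ (i, i)) = (\<Sum>i<n. \<Sum>\<phi>\<leftarrow>F. ketbra \<phi> $$ (i, i))"
    using assms by (intro sum.cong refl) (subst mat_sum_index, auto simp: o_def intro!: ketbra_carrier)
  also have "\<dots> = (\<Sum>\<phi>\<leftarrow>F. \<Sum>i<n. ketbra \<phi> $$ (i, i))"
    by (rule sum_list_sum_swap [symmetric])
  also have "\<dots> = (\<Sum>\<phi>\<leftarrow>F. complex_of_real (norm_sq \<phi>))"
  proof (intro arg_cong [of _ _ sum_list] map_cong refl)
    fix \<phi> assume "\<phi> \<in> set F"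
    then have "\<phi> \<in> carrier_vec n" using assms by auto
    then show "(\<Sum>i<n. ketbra \<phi> $$ (i, i)) = complex_of_real (norm_sq \<phi>)"
      unfolding cscalar_self [symmetric] by (simp add: cscalar_sum ketbra_def)
  qed
  also have "\<dots> = complex_of_real (\<Sum>\<phi>\<leftarrow>F. norm_sq \<phi>)" by (induction F) simp_all
  finally show ?thesis .
qed

lemma density_mat_vector_decomposition:
  assumes "density_mat n \<rho>"
  obtains F where "vector_decomposition n \<rho> F"
proof -
  have \<rho>: "\<rho> \<in> carrier_mat n n" and tr: "(\<Sum>i<n. \<rho> $$ (i, i)) = 1"
    and pos: "\<And>v. v \<in> carrier_vec n \<Longrightarrow> 0 \<le> (\<rho> *\<^sub>v v) \<bullet>c v"
    using assms by (auto simp: density_mat_def)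
  have "0 \<le> sesq n \<rho> v v" for v
  proof -
    have v: "vec n v \<in> carrier_vec n" by simp
    have "(\<rho> *\<^sub>v vec n v) \<bullet>c vec n v = sesq n \<rho> v v"
      unfolding cscalar_sum [OF v] sesq_def
      by (intro sum.cong refl)
        (simp add: mult_mat_vec_sum [OF \<rho> v] sum_distrib_right del: index_mult_mat_vec)
    then show ?thesis using pos [OF v] by simp
  qed
  then obtain F where F: "set F \<subseteq> carrier_vec n" "\<rho> = mat_sum n n (map ketbra F)"
    using psd_ketbra_sum [OF \<rho>, of 0] by auto
  with tr have "complex_of_real (\<Sum>\<phi>\<leftarrow>F. norm_sq \<phi>) = 1" using trace_ketbra_sum [OF F(1)] by simp
  with F have "vector_decomposition n \<rho> F"
    unfolding vector_decomposition_def of_real_eq_1_iff by simp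
  then show thesis by (rule that)
qed

subsection \<open>Closedness of the set of separable states\<close>

text \<open>Gaussian elimination: an unknown k that occurs in the last equation is eliminated from
  all others, which leaves one equation and one unknown fewer.\<close>

lemma homogeneous_system_nontrivial_solution:
  fixes X :: "'i \<Rightarrow> nat \<Rightarrow> real"
  assumes "finite I" "D < card I"
  shows "\<exists>c. (\<exists>i\<in>I. c i \<noteq> 0) \<and> (\<forall>d<D. (\<Sum>i\<in>I. c i * X i d) = 0)"
  using assms
proof (induction D arbitrary: I X)
  case 0
  then obtain i where "i \<in> I" by fastforce
  then show ?case by (intro exI [of _ "\<lambda>_. 1"]) auto
next
  case (Suc D)
  show ?case
  proof (cases "\<forall>i\<in>I. X i D = 0")
    case True
    obtain c where "\<exists>i\<in>I. c i \<noteq> 0" "\<forall>d<D. (\<Sum>i\<in>I. c i * X i d) = 0"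
      using Suc.IH [of I X] Suc.prems by auto
    with True show ?thesis by (intro exI [of _ c]) (auto simp: less_Suc_eq)
  next
    case False
    then obtain k where k: "k \<in> I" "X k D \<noteq> 0" by blast
    let ?Y = "\<lambda>i d. X i d - X i D / X k D * X k d"
    have "D < card (I - {k})" using Suc.prems k by simp
    then obtain c where c: "\<exists>i\<in>I - {k}. c i \<noteq> 0" "\<forall>d<D. (\<Sum>i\<in>I - {k}. c i * ?Y i d) = 0"
      using Suc.IH [of "I - {k}" ?Y] Suc.prems by auto
    \<comment> \<open>The last equation forces the value - s on the eliminated unknown.\<close>
    define s where "s = (\<Sum>i\<in>I - {k}. c i * X i D) / X k D"
    define c' where "c' i = (if i = k then - s else c i)" for i
    have split: "(\<Sum>i\<in>I. c' i * X i d) = (\<Sum>i\<in>I - {k}. c i * X i d) - s * X k d" for d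
      using Suc.prems k by (simp add: sum.remove [of I k] c'_def)
    have "(\<Sum>i\<in>I. c' i * X i d) = 0" if "d < Suc D" for d
    proof (cases "d = D")
      case True
      then show ?thesis using k unfolding split by (simp add: s_def)
    next
      case False
      with that c have "(\<Sum>i\<in>I - {k}. c i * ?Y i d) = 0" by auto
      then show ?thesis
        unfolding split s_def
        by (simp add: right_diff_distrib sum_subtractf sum_distrib_right sum_divide_distrib mult.assoc)
    qed
    moreover have "\<exists>i\<in>I. c' i \<noteq> 0" using c(1) by (auto simp: c'_def)
    ultimately show ?thesis by blast
  qed
qed

text \<open>More than D vectors with D coordinates are linearly dependent. Subtracting a suitable
  multiple of a dependence leaves the combination unchanged, keeps the coefficients nonnegative and
  removes one of them.\<close>

lemma conic_caratheodory:
  fixes X :: "'i \<Rightarrow> nat \<Rightarrow> real"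
  assumes "finite I" "\<And>i. i \<in> I \<Longrightarrow> 0 \<le> t i"
  shows "\<exists>J s. J \<subseteq> I \<and> card J \<le> D \<and> (\<forall>i\<in>J. 0 \<le> s i) \<and>
    (\<forall>d<D. (\<Sum>i\<in>J. s i * X i d) = (\<Sum>i\<in>I. t i * X i d))"
  using assms
proof (induction "card I" arbitrary: I t rule: less_induct)
  case less
  note fin = less.prems(1)
  show ?case
  proof (cases "card I \<le> D")
    case True
    then show ?thesis using less.prems by blast
  next
    case False
    then obtain c0 where c0: "\<exists>i\<in>I. c0 i \<noteq> 0" "\<forall>d<D. (\<Sum>i\<in>I. c0 i * X i d) = 0"
      using homogeneous_system_nontrivial_solution [OF fin, of D X] by auto
    \<comment> \<open>Passing to the negative if necessary, the dependence has a positive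
      coefficient, so a minimal ratio can be taken.\<close>
    obtain c where c: "\<exists>i\<in>I. 0 < c i" "\<forall>d<D. (\<Sum>i\<in>I. c i * X i d) = 0"
    proof (cases "\<exists>i\<in>I. 0 < c0 i")
      case True
      then show thesis using c0 that by blast
    next
      case False
      moreover from c0(1) obtain i where "i \<in> I" "c0 i \<noteq> 0" by blast
      ultimately have "\<exists>i\<in>I. 0 < - c0 i" by (intro bexI [of _ i]) (auto simp: not_less order.strict_iff_order)
      then show thesis using c0(2) by (intro that [of "\<lambda>i. - c0 i"]) (auto simp: sum_negf)
    qed
    let ?P = "{i \<in> I. 0 < c i}"
    obtain k where k: "k \<in> ?P" "\<And>i. i \<in> ?P \<Longrightarrow> t k / c k \<le> t i / c i"
      using ex_min_if_finite [of "(\<lambda>i. t i / c i) ` ?P"] fin c(1)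
      by (auto simp: not_less) (metis (no_types, lifting) linorder_not_less)
    \<comment> \<open>The largest multiple of c that can be subtracted without a coefficient turning
      negative; the one at k becomes zero.\<close>
    define q where "q = t k / c k"
    define u where "u i = t i - q * c i" for i
    have q: "0 \<le> q" using k less.prems(2) by (simp add: q_def)
    have u: "0 \<le> u i" if "i \<in> I" for i
    proof (cases "0 < c i")
      case True
      then show ?thesis using k(2) [of i] that by (simp add: u_def q_def field_simps)
    next
      case False
      then have "q * c i \<le> 0" using q by (simp add: mult_nonneg_nonpos)
      then show ?thesis using less.prems(2) [OF that] by (simp add: u_def)
    qed
    have uk: "u k = 0" using k by (simp add: u_def q_def)
    have "card (I - {k}) < card I" using k fin by (intro card_Diff1_less) auto
    then obtain J s where J: "J \<subseteq> I - {k}" "card J \<le> D" "\<forall>i\<in>J. 0 \<le> s i"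
      "\<forall>d<D. (\<Sum>i\<in>J. s i * X i d) = (\<Sum>i\<in>I - {k}. u i * X i d)"
      using less.hyps [of "I - {k}" u] fin u by auto
    have "(\<Sum>i\<in>I - {k}. u i * X i d) = (\<Sum>i\<in>I. t i * X i d)" if "d < D" for d
    proof -
      have "(\<Sum>i\<in>I - {k}. u i * X i d) = (\<Sum>i\<in>I. u i * X i d)"
        using k fin uk by (simp add: sum.remove [of I k])
      also have "\<dots> = (\<Sum>i\<in>I. t i * X i d) - q * (\<Sum>i\<in>I. c i * X i d)"
        by (simp add: u_def left_diff_distrib sum_subtractf sum_distrib_left mult.assoc)
      finally show ?thesis using c(2) that by simp
    qed
    with J show ?thesis by (metis Diff_subset subset_trans)
  qed
qed

section \<open>Compactness\<close>

text \<open>Coordinates are treated one after another: a bounded sequence has a monotone, hence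
  convergent, subsequence, and thinning out preserves the limits already obtained.\<close>

lemma convergent_subsequence_real:
  fixes f :: "nat \<Rightarrow> 'j \<Rightarrow> real"
  assumes "finite J" "\<And>k j. j \<in> J \<Longrightarrow> \<bar>f k j\<bar> \<le> C"
  shows "\<exists>r l. strict_mono r \<and> (\<forall>j\<in>J. (\<lambda>k. f (r k) j) \<longlonglongrightarrow> l j)"
  using assms
proof (induction J)
  case empty
  show ?case by (intro exI [of _ id]) (simp add: strict_mono_def)
next
  case (insert j J)
  then obtain r l where r: "strict_mono (r :: nat \<Rightarrow> nat)" "\<forall>j\<in>J. (\<lambda>k. f (r k) j) \<longlonglongrightarrow> l j" by auto
  obtain s where s: "strict_mono s" "monoseq (\<lambda>k. f (r (s k)) j)"
    using seq_monosub [of "\<lambda>k. f (r k) j"] by auto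
  have "Bseq (\<lambda>k. f (r (s k)) j)" using insert.prems by (intro BseqI' [of _ C]) auto
  then obtain L where L: "(\<lambda>k. f (r (s k)) j) \<longlonglongrightarrow> L"
    using Bseq_monoseq_convergent s(2) by (auto simp: convergent_def)
  have "(\<lambda>k. f (r (s k)) i) \<longlonglongrightarrow> l i" if "i \<in> J" for i
    using LIMSEQ_subseq_LIMSEQ [OF r(2) [rule_format, OF that] s(1)] by (simp add: o_def)
  then have "\<forall>i\<in>insert j J. (\<lambda>k. f ((r \<circ> s) k) i) \<longlonglongrightarrow> (l(j := L)) i"
    using L insert.hyps by auto
  then show ?case using strict_mono_o [OF r(1) s(1)] by blast
qed

lemma convergent_subsequence_complex:
  fixes f :: "nat \<Rightarrow> 'j \<Rightarrow> complex"
  assumes "finite J" "\<And>k j. j \<in> J \<Longrightarrow> cmod (f k j) \<le> C"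
  shows "\<exists>r l. strict_mono r \<and> (\<forall>j\<in>J. (\<lambda>k. f (r k) j) \<longlonglongrightarrow> l j)"
proof -
  let ?g = "\<lambda>k (j, b). if b then Re (f k j) else Im (f k j)"
  have "\<bar>?g k (j, b)\<bar> \<le> C" if "j \<in> J" for k j b
    using abs_Re_le_cmod [of "f k j"] abs_Im_le_cmod [of "f k j"] assms(2) [OF that, of k] by auto
  then obtain r l where r: "strict_mono (r :: nat \<Rightarrow> nat)"
    and l: "\<forall>i\<in>J \<times> UNIV. (\<lambda>k. ?g (r k) i) \<longlonglongrightarrow> l i"
    using convergent_subsequence_real [of "J \<times> (UNIV :: bool set)" ?g C] assms(1) by auto
  have "(\<lambda>k. f (r k) j) \<longlonglongrightarrow> Complex (l (j, True)) (l (j, False))" if "j \<in> J" for j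
    using l [rule_format, of "(j, True)"] l [rule_format, of "(j, False)"] that
    by (simp add: tendsto_complex_iff)
  with r show ?thesis by (intro exI [of _ r] exI [of _ "\<lambda>j. Complex (l (j, True)) (l (j, False))"]) blast
qed

section \<open>Ensembles of product states\<close>

lemma norm_sq_tensor_vec:
  assumes "x \<in> carrier_vec m" "y \<in> carrier_vec n"
  shows "norm_sq (tensor_vec x y) = norm_sq x * norm_sq y"
proof -
  have "norm_sq (tensor_vec x y) = (\<Sum>k<m * n. (cmod (tensor_vec x y $ k))\<^sup>2)"
    using tensor_vec_carrier [OF assms] by (simp add: norm_sq_def)
  also have "\<dots> = (\<Sum>i<m. \<Sum>j<n. (cmod (x $ i))\<^sup>2 * (cmod (y $ j))\<^sup>2)"
    unfolding sum_prod_index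
    by (intro sum.cong refl) (simp add: tensor_vec_index [OF assms] norm_mult power_mult_distrib)
  also have "\<dots> = norm_sq x * norm_sq y"
    using assms by (simp add: norm_sq_def sum_product)
  finally show ?thesis .
qed

lemma pure_state_tensor_vec:
  "pure_state m x \<Longrightarrow> pure_state n y \<Longrightarrow> pure_state (m * n) (tensor_vec x y)"
  by (auto simp: pure_state_iff norm_sq_tensor_vec tensor_vec_carrier)

lemma index_split:
  assumes "k < m * (n :: nat)"
  shows "k div n < m" "k mod n < n"
proof -
  show "k div n < m" using assms by (rule less_mult_imp_div_less)
  have "0 < n" using assms by (cases n) auto
  then show "k mod n < n" by simp
qed

lemma tensor_mat_ketbra:
  assumes "x \<in> carrier_vec m" "y \<in> carrier_vec n"
  shows "tensor_mat (ketbra x) (ketbra y) = ketbra (tensor_vec x y)"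
  using assms index_split [of _ m n]
  by (intro eq_matI) (auto simp: tensor_mat_def tensor_vec_def ketbra_def)

lemma trace_ketbra_pure:
  "pure_state n v \<Longrightarrow> (\<Sum>i<n. ketbra v $$ (i, i)) = 1"
  using cscalar_sum [of v n v] by (auto simp: pure_state_def ketbra_def)

definition product_ensemble :: "nat \<Rightarrow> nat \<Rightarrow> (real \<times> complex vec \<times> complex vec) list \<Rightarrow> bool" where
  "product_ensemble m n E \<longleftrightarrow>
     (\<forall>(p, a, b) \<in> set E. 0 \<le> p \<and> pure_state m a \<and> pure_state n b) \<and> (\<Sum>(p, a, b)\<leftarrow>E. p) = 1"

text \<open>Separate entries turn statements about matrices into scalar ones, to which
  Caratheodory's theorem and limits apply directly.\<close>

definition ensemble_entry :: "(real \<times> complex vec \<times> complex vec) list \<Rightarrow> nat \<Rightarrow> nat \<Rightarrow> complex" where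
  "ensemble_entry E i j = (\<Sum>(p, a, b)\<leftarrow>E. complex_of_real p * ketbra (tensor_vec a b) $$ (i, j))"

lemma ensemble_summand_carrier:
  assumes "product_ensemble m n E"
  shows "set [complex_of_real p \<cdot>\<^sub>m tensor_mat (ketbra a) (ketbra b). (p, a, b) \<leftarrow> E]
    \<subseteq> carrier_mat (m * n) (m * n)"
  using assms
  by (auto simp: product_ensemble_def pure_state_def intro!: smult_carrier_mat tensor_mat_carrier ketbra_carrier)

lemma ensemble_entry_eq:
  assumes E: "product_ensemble m n E" and ij: "i < m * n" "j < m * n"
  shows "mat_sum (m * n) (m * n) [complex_of_real p \<cdot>\<^sub>m tensor_mat (ketbra a) (ketbra b). (p, a, b) \<leftarrow> E]
    $$ (i, j) = ensemble_entry E i j"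
  unfolding mat_sum_index [OF ensemble_summand_carrier [OF E] ij] ensemble_entry_def map_map
proof (intro arg_cong [of _ _ sum_list] map_cong refl)
  fix e assume e: "e \<in> set E"
  obtain p a b where pab: "e = (p, a, b)" by (cases e)
  with e E have ab: "a \<in> carrier_vec m" "b \<in> carrier_vec n"
    by (auto simp: product_ensemble_def pure_state_def)
  then have "ketbra (tensor_vec a b) \<in> carrier_mat (m * n) (m * n)"
    by (intro ketbra_carrier tensor_vec_carrier)
  then show "((\<lambda>M. M $$ (i, j)) \<circ> (\<lambda>(p, a, b). complex_of_real p \<cdot>\<^sub>m tensor_mat (ketbra a) (ketbra b))) e =
      (case e of (p, a, b) \<Rightarrow> complex_of_real p * ketbra (tensor_vec a b) $$ (i, j))"
    using ij by (simp add: pab tensor_mat_ketbra [OF ab])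
qed

lemma separable_state_iff:
  assumes "\<rho> \<in> carrier_mat (m * n) (m * n)"
  shows "separable_state m n \<rho> \<longleftrightarrow> (\<exists>E. product_ensemble m n E \<and>
    (\<forall>i<m * n. \<forall>j<m * n. \<rho> $$ (i, j) = ensemble_entry E i j))"
proof -
  have "\<rho> = mat_sum (m * n) (m * n) [complex_of_real p \<cdot>\<^sub>m tensor_mat (ketbra a) (ketbra b). (p, a, b) \<leftarrow> E]
      \<longleftrightarrow> (\<forall>i<m * n. \<forall>j<m * n. \<rho> $$ (i, j) = ensemble_entry E i j)"
    if E: "product_ensemble m n E" for E
    using assms mat_sum_carrier [OF ensemble_summand_carrier [OF E]] ensemble_entry_eq [OF E]
    by (subst mat_eq_iff) auto
  then show ?thesis
    unfolding separable_state_def product_ensemble_def [symmetric] by (metis (no_types, lifting) product_ensemble_def)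
qed

lemma ensemble_trace:
  assumes E: "product_ensemble m n E"
  shows "(\<Sum>i<m * n. ensemble_entry E i i) = 1"
proof -
  have "(\<Sum>i<m * n. ensemble_entry E i i) =
      (\<Sum>e\<leftarrow>E. \<Sum>i<m * n. (case e of (p, a, b) \<Rightarrow> complex_of_real p * ketbra (tensor_vec a b) $$ (i, i)))"
    unfolding ensemble_entry_def by (rule sum_list_sum_swap [symmetric])
  also have "\<dots> = (\<Sum>(p, a, b)\<leftarrow>E. complex_of_real p)"
  proof (intro arg_cong [of _ _ sum_list] map_cong refl, clarify)
    fix p a b assume "(p, a, b) \<in> set E"
    then have "pure_state (m * n) (tensor_vec a b)"
      using E by (auto simp: product_ensemble_def intro!: pure_state_tensor_vec)
    from trace_ketbra_pure [OF this]
    show "(\<Sum>i<m * n. complex_of_real p * ketbra (tensor_vec a b) $$ (i, i)) = complex_of_real p"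
      by (simp add: sum_distrib_left [symmetric])
  qed
  also have "\<dots> = complex_of_real (\<Sum>(p, a, b)\<leftarrow>E. p)" by (induction E) auto
  also have "\<dots> = 1" using E by (simp add: product_ensemble_def)
  finally show ?thesis .
qed

text \<open>The real and imaginary parts of the entries of an \<open>n \<times> n\<close> matrix are its \<open>2 * n * n\<close>
  coordinates.\<close>

lemma product_ensemble_reduce:
  fixes m n :: nat
  defines "D \<equiv> 2 * ((m * n) * (m * n))"
  assumes E: "product_ensemble m n E"
  obtains E' where "product_ensemble m n E'" "length E' = D"
    "\<And>i j. i < m * n \<Longrightarrow> j < m * n \<Longrightarrow> ensemble_entry E' i j = ensemble_entry E i j"
proof -
  let ?N = "m * n"
  define p a b where "p i = fst (E ! i)" and "a i = fst (snd (E ! i))" and "b i = snd (snd (E ! i))" for i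
  have Ei: "E ! i = (p i, a i, b i)" for i by (simp add: p_def a_def b_def)
  have pure: "0 \<le> p i" "pure_state m (a i)" "pure_state n (b i)" if "i < length E" for i
    using E nth_mem [OF that] by (auto simp: product_ensemble_def Ei)
  \<comment> \<open>Half of d encodes the position of the entry, and the parity of d selects its
    real or imaginary part.\<close>
  define X where "X i d = (let z = ketbra (tensor_vec (a i) (b i)) $$ (d div 2 div ?N, d div 2 mod ?N)
      in if even d then Re z else Im z)" for i d
  obtain J s where J: "J \<subseteq> {..<length E}" "card J \<le> D" "\<forall>i\<in>J. 0 \<le> s i"
    and eq: "\<forall>d<D. (\<Sum>i\<in>J. s i * X i d) = (\<Sum>i<length E. p i * X i d)"
    using conic_caratheodory [of "{..<length E}" p D X] pure(1) by auto
  have fin: "finite J" using J(1) finite_subset by blast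
  obtain h where h: "bij_betw h {..<card J} J"
    using ex_bij_betw_nat_finite [OF fin] by (auto simp: lessThan_atLeast0)
  have E0: "0 < length E" using E by (cases E) (auto simp: product_ensemble_def)
  \<comment> \<open>Terms of weight zero pad the list to length exactly D. Their vectors are those
    of the first term of E, which exists because the weights of E sum to 1.\<close>
  define E' where "E' = map (\<lambda>l. if l < card J then (s (h l), a (h l), b (h l)) else (0, a 0, b 0)) [0..<D]"
  have hJ: "h l \<in> J" if "l < card J" for l using h that by (auto simp: bij_betw_def)
  have ent: "ensemble_entry E' i j = ensemble_entry E i j" if ij: "i < ?N" "j < ?N" for i j
  proof -
    let ?z = "\<lambda>k. ketbra (tensor_vec (a k) (b k)) $$ (i, j)"
    define d where "d = 2 * (i * ?N + j)"
    have dD: "d < D" "Suc d < D"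
      using pair_index_less [OF ij] by (auto simp: d_def D_def)
    have dij: "d div 2 div ?N = i" "d div 2 mod ?N = j" "Suc d div 2 div ?N = i" "Suc d div 2 mod ?N = j"
      "even d" "odd (Suc d)"
    proof -
      have "(i * N + j) div N = i" "(i * N + j) mod N = j" if "j < N" for N
        using that by simp_all
      note this [OF ij(2)]
      then show "d div 2 div ?N = i" "d div 2 mod ?N = j" "Suc d div 2 div ?N = i" "Suc d div 2 mod ?N = j"
        "even d" "odd (Suc d)"
        by (simp_all add: d_def del: div_mult_self1 div_mult_self2 div_mult_self3 div_mult_self4)
    qed
    have X: "X k d = Re (?z k)" "X k (Suc d) = Im (?z k)" for k
      unfolding X_def Let_def using dij by simp_all
    have "ensemble_entry E' i j =
        (\<Sum>l<D. if l < card J then complex_of_real (s (h l)) * ?z (h l) else 0)"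
      unfolding ensemble_entry_def E'_def map_map
      by (simp add: sum_list_sum_nth lessThan_atLeast0 if_distrib cong: if_cong)
    also have "\<dots> = (\<Sum>l<card J. complex_of_real (s (h l)) * ?z (h l))"
      by (rule sum.mono_neutral_cong_right) (use J(2) in auto)
    also have "\<dots> = (\<Sum>k\<in>J. complex_of_real (s k) * ?z k)"
      by (rule sum.reindex_bij_betw [OF h])
    also have "\<dots> = (\<Sum>k<length E. complex_of_real (p k) * ?z k)"
      using eq [rule_format, OF dD(1)] eq [rule_format, OF dD(2)]
      by (intro complex_eqI) (simp_all add: X)
    also have "\<dots> = ensemble_entry E i j"
      unfolding ensemble_entry_def by (simp add: sum_list_sum_nth lessThan_atLeast0 Ei)
    finally show ?thesis .
  qed
  have E'1: "\<forall>(p, a, b) \<in> set E'. 0 \<le> p \<and> pure_state m a \<and> pure_state n b"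
    using J hJ pure E0 by (auto simp: E'_def subset_iff)
  \<comment> \<open>The reduction for cones does not fix the sum of the weights. It is recovered as
    the trace, which is determined by the preserved entries.\<close>
  have "complex_of_real (\<Sum>(p, a, b)\<leftarrow>E'. p) = (\<Sum>(p, a, b)\<leftarrow>E'. complex_of_real p)"
    by (induction E') auto
  also have "\<dots> = (\<Sum>e\<leftarrow>E'. \<Sum>i<?N. (case e of (p, a, b) \<Rightarrow> complex_of_real p * ketbra (tensor_vec a b) $$ (i, i)))"
  proof (intro arg_cong [of _ _ sum_list] map_cong refl, clarify)
    fix p a b assume "(p, a, b) \<in> set E'"
    then have "pure_state ?N (tensor_vec a b)"
      using E'1 by (auto intro!: pure_state_tensor_vec)
    from trace_ketbra_pure [OF this]
    show "complex_of_real p = (\<Sum>i<?N. complex_of_real p * ketbra (tensor_vec a b) $$ (i, i))"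
      by (simp add: sum_distrib_left [symmetric])
  qed
  also have "\<dots> = (\<Sum>i<?N. ensemble_entry E' i i)"
    unfolding ensemble_entry_def by (rule sum_list_sum_swap)
  also have "\<dots> = 1"
    using ent ensemble_trace [OF E] by simp
  finally have "(\<Sum>(p, a, b)\<leftarrow>E'. p) = 1" by (simp only: of_real_eq_1_iff)
  with E'1 ent show thesis by (intro that [of E']) (auto simp: product_ensemble_def E'_def)
qed

lemma pure_state_entry_le_1:
  assumes "pure_state n v" "i < n"
  shows "cmod (v $ i) \<le> 1"
proof -
  have "(cmod (v $ i))\<^sup>2 \<le> norm_sq v"
    unfolding norm_sq_def using assms by (intro member_le_sum) (auto simp: pure_state_def)
  then show ?thesis using assms by (simp add: pure_state_iff power2_le_iff_abs_le abs_square_le_1)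
qed

lemma separable_state_limit:
  assumes \<rho>: "\<rho> \<in> carrier_mat (m * n) (m * n)"
    and approx: "\<And>e. 0 < e \<Longrightarrow> \<exists>E. product_ensemble m n E \<and>
      (\<forall>i<m * n. \<forall>j<m * n. cmod (\<rho> $$ (i, j) - ensemble_entry E i j) < e)"
  shows "separable_state m n \<rho>"
proof -
  define D where "D = 2 * ((m * n) * (m * n))"
  \<comment> \<open>With a common length D, the weights and vectors at a given position form
    sequences in k.\<close>
  have "\<exists>E. product_ensemble m n E \<and> length E = D \<and>
      (\<forall>i<m * n. \<forall>j<m * n. cmod (\<rho> $$ (i, j) - ensemble_entry E i j) < 1 / real (Suc k))" for k
  proof -
    obtain E where E: "product_ensemble m n E"
      "\<forall>i<m * n. \<forall>j<m * n. cmod (\<rho> $$ (i, j) - ensemble_entry E i j) < 1 / real (Suc k)"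
      using approx [of "1 / real (Suc k)"] by auto
    from product_ensemble_reduce [OF E(1)] obtain E' where "product_ensemble m n E'" "length E' = D"
      "\<And>i j. i < m * n \<Longrightarrow> j < m * n \<Longrightarrow> ensemble_entry E' i j = ensemble_entry E i j"
      unfolding D_def by blast
    with E(2) show ?thesis by metis
  qed
  then obtain E where E: "\<And>k. product_ensemble m n (E k)" and len: "\<And>k. length (E k) = D"
    and close: "\<And>k i j. i < m * n \<Longrightarrow> j < m * n \<Longrightarrow>
      cmod (\<rho> $$ (i, j) - ensemble_entry (E k) i j) < 1 / real (Suc k)"
    by metis
  define p a b where "p k l = fst (E k ! l)" and "a k l = fst (snd (E k ! l))"
    and "b k l = snd (snd (E k ! l))" for k l
  have El: "E k ! l = (p k l, a k l, b k l)" for k l by (simp add: p_def a_def b_def)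
  have pure: "0 \<le> p k l" "pure_state m (a k l)" "pure_state n (b k l)" if "l < D" for k l
    using E [of k] nth_mem [of l "E k"] that len by (auto simp: product_ensemble_def El)
  have sum1: "(\<Sum>l<D. p k l) = 1" for k
    using E [of k] by (simp add: product_ensemble_def sum_list_sum_nth len El lessThan_atLeast0)
  have p1: "p k l \<le> 1" if "l < D" for k l
    using member_le_sum [of l "{..<D}" "p k"] sum1 [of k] pure(1) that by auto
  \<comment> \<open>All weights and vector components in one bounded family with finite index set,
    so that a single subsequence serves them all; s tells weights (0), A vectors (1) and B vectors
    (2) apart.\<close>
  define f where "f k = (\<lambda>(s, l, i). if s = (0::nat) then complex_of_real (p k l)
    else if s = 1 then a k l $ i else b k l $ i)" for k
  define J where "J = {0} \<times> {..<D} \<times> {0} \<union> {1} \<times> {..<D} \<times> {..<m} \<union> {2::nat} \<times> {..<D} \<times> {..<n}"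
  have "finite J" by (simp add: J_def)
  moreover have "cmod (f k x) \<le> 1" if "x \<in> J" for k x
    using that pure p1 by (auto simp: J_def f_def intro: pure_state_entry_le_1 [OF pure(2)] pure_state_entry_le_1 [OF pure(3)])
  ultimately obtain r L where r: "strict_mono (r :: nat \<Rightarrow> nat)"
    and L: "\<forall>x\<in>J. (\<lambda>k. f (r k) x) \<longlonglongrightarrow> L x"
    using convergent_subsequence_complex [of J f 1] by blast
  define P A B where "P l = Re (L (0, l, 0))" and "A l = vec m (\<lambda>i. L (1, l, i))"
    and "B l = vec n (\<lambda>i. L (2, l, i))" for l
  have limp: "(\<lambda>k. p (r k) l) \<longlonglongrightarrow> P l" if "l < D" for l
    using tendsto_Re [OF L [rule_format, of "(0, l, 0)"]] that by (simp add: J_def f_def P_def)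
  have lima: "(\<lambda>k. a (r k) l $ i) \<longlonglongrightarrow> A l $ i" if "l < D" "i < m" for l i
    using L [rule_format, of "(1, l, i)"] that by (simp add: J_def f_def A_def)
  have limb: "(\<lambda>k. b (r k) l $ i) \<longlonglongrightarrow> B l $ i" if "l < D" "i < n" for l i
    using L [rule_format, of "(2, l, i)"] that by (simp add: J_def f_def B_def)
  have ac: "a k l \<in> carrier_vec m" "norm_sq (a k l) = 1" and bc: "b k l \<in> carrier_vec n" "norm_sq (b k l) = 1"
    if "l < D" for k l
    using pure [OF that] by (auto simp: pure_state_iff)
  have A: "pure_state m (A l)" if "l < D" for l
  proof -
    have "(\<lambda>k. \<Sum>i<m. (cmod (a (r k) l $ i))\<^sup>2) \<longlonglongrightarrow> (\<Sum>i<m. (cmod (A l $ i))\<^sup>2)"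
      using lima that by (intro tendsto_intros) auto
    moreover have "(\<Sum>i<m. (cmod (a (r k) l $ i))\<^sup>2) = 1" for k
      using ac [OF that, of "r k"] by (auto simp: norm_sq_def)
    ultimately have "(\<Sum>i<m. (cmod (A l $ i))\<^sup>2) = 1" by (simp add: LIMSEQ_const_iff)
    then show ?thesis by (simp add: pure_state_iff norm_sq_def A_def)
  qed
  have B: "pure_state n (B l)" if "l < D" for l
  proof -
    have "(\<lambda>k. \<Sum>i<n. (cmod (b (r k) l $ i))\<^sup>2) \<longlonglongrightarrow> (\<Sum>i<n. (cmod (B l $ i))\<^sup>2)"
      using limb that by (intro tendsto_intros) auto
    moreover have "(\<Sum>i<n. (cmod (b (r k) l $ i))\<^sup>2) = 1" for k
      using bc [OF that, of "r k"] by (auto simp: norm_sq_def)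
    ultimately have "(\<Sum>i<n. (cmod (B l $ i))\<^sup>2) = 1" by (simp add: LIMSEQ_const_iff)
    then show ?thesis by (simp add: pure_state_iff norm_sq_def B_def)
  qed
  have P: "0 \<le> P l" if "l < D" for l
    using LIMSEQ_le_const [OF limp [OF that]] pure(1) [OF that] by auto
  have "(\<lambda>k. \<Sum>l<D. p (r k) l) \<longlonglongrightarrow> (\<Sum>l<D. P l)"
    using limp by (intro tendsto_intros) auto
  then have P1: "(\<Sum>l<D. P l) = 1" by (simp add: sum1 LIMSEQ_const_iff)
  define F where "F = map (\<lambda>l. (P l, A l, B l)) [0..<D]"
  have F: "product_ensemble m n F"
    using P A B P1 by (auto simp: product_ensemble_def F_def sum_list_sum_nth lessThan_atLeast0)
  have "\<rho> $$ (i, j) = ensemble_entry F i j" if ij: "i < m * n" "j < m * n" for i j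
  proof -
    note s = index_split [OF ij(1)] index_split [OF ij(2)]
    have kb: "ketbra (tensor_vec x y) $$ (i, j) =
        x $ (i div n) * y $ (i mod n) * cnj (x $ (j div n) * y $ (j mod n))"
      if "x \<in> carrier_vec m" "y \<in> carrier_vec n" for x y
      using that ij by (simp add: ketbra_def tensor_vec_def)
    have ek: "ensemble_entry (E k) i j = (\<Sum>l<D. complex_of_real (p k l) *
        (a k l $ (i div n) * b k l $ (i mod n) * cnj (a k l $ (j div n) * b k l $ (j mod n))))" for k
      unfolding ensemble_entry_def using ac bc
      by (simp add: sum_list_sum_nth len El lessThan_atLeast0 kb)
    have eF: "ensemble_entry F i j = (\<Sum>l<D. complex_of_real (P l) *
        (A l $ (i div n) * B l $ (i mod n) * cnj (A l $ (j div n) * B l $ (j mod n))))"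
      unfolding ensemble_entry_def F_def using A B
      by (simp add: sum_list_sum_nth lessThan_atLeast0 kb A_def B_def)
    \<comment> \<open>The entries are polynomials in the weights, the components and their
      conjugates.\<close>
    have "(\<lambda>k. ensemble_entry (E (r k)) i j) \<longlonglongrightarrow> ensemble_entry F i j"
      unfolding ek eF using s by (intro tendsto_intros limp lima limb) auto
    moreover have "(\<lambda>k. ensemble_entry (E k) i j) \<longlonglongrightarrow> \<rho> $$ (i, j)"
    proof (rule LIMSEQ_I)
      fix e :: real assume "0 < e"
      then obtain K where K: "1 / real (Suc K) < e" using nat_approx_posE by blast
      show "\<exists>K. \<forall>k\<ge>K. cmod (ensemble_entry (E k) i j - \<rho> $$ (i, j)) < e"
      proof (intro exI allI impI)
        fix k assume "K \<le> k"
        then have "1 / real (Suc k) \<le> 1 / real (Suc K)" by (simp add: frac_le)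
        with K close [OF ij, of k] show "cmod (ensemble_entry (E k) i j - \<rho> $$ (i, j)) < e"
          by (simp add: norm_minus_commute)
      qed
    qed
    then have "(\<lambda>k. ensemble_entry (E (r k)) i j) \<longlonglongrightarrow> \<rho> $$ (i, j)"
      using LIMSEQ_subseq_LIMSEQ [OF _ r] by (auto simp: o_def)
    ultimately show ?thesis by (metis LIMSEQ_unique)
  qed
  with F show ?thesis unfolding separable_state_iff [OF \<rho>] by blast
qed

section \<open>Approximation by product states\<close>

lemma norm_sum_list_le:
  fixes f :: "'a \<Rightarrow> 'b::real_normed_vector"
  shows "norm (\<Sum>x\<leftarrow>xs. f x) \<le> (\<Sum>x\<leftarrow>xs. norm (f x))"
  by (induction xs) (auto intro: norm_triangle_le)

text \<open>The right-hand side is the squared Hilbert-Schmidt distance of the two projectors, which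
  dominates the contribution of any single entry.\<close>

lemma ketbra_entry_diff:
  assumes \<psi>: "pure_state n \<psi>" and v: "pure_state n v" and ij: "i < n" "j < n"
  shows "(cmod (ketbra \<psi> $$ (i, j) - ketbra v $$ (i, j)))\<^sup>2 \<le> 2 - 2 * (cmod (\<psi> \<bullet>c v))\<^sup>2"
proof -
  have c: "\<psi> \<in> carrier_vec n" "v \<in> carrier_vec n"
    and one: "(\<Sum>i<n. \<psi> $ i * cnj (\<psi> $ i)) = 1" "(\<Sum>i<n. v $ i * cnj (v $ i)) = 1"
    using \<psi> v cscalar_sum [of \<psi> n \<psi>] cscalar_sum [of v n v] by (auto simp: pure_state_def)
  let ?d = "\<lambda>i j. \<psi> $ i * cnj (\<psi> $ j) - v $ i * cnj (v $ j)"
  let ?z = "\<psi> \<bullet>c v"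
  have z: "?z = (\<Sum>i<n. \<psi> $ i * cnj (v $ i))" by (rule cscalar_sum [OF c(2)])
  have "complex_of_real (\<Sum>i<n. \<Sum>j<n. (cmod (?d i j))\<^sup>2) = (\<Sum>i<n. \<Sum>j<n. ?d i j * cnj (?d i j))"
    by (simp only: of_real_sum complex_norm_square)
  also have "\<dots> = (\<Sum>i<n. \<Sum>j<n. (\<psi> $ i * cnj (\<psi> $ i)) * (\<psi> $ j * cnj (\<psi> $ j))
      - (\<psi> $ i * cnj (v $ i)) * cnj (\<psi> $ j * cnj (v $ j))
      - cnj (\<psi> $ i * cnj (v $ i)) * (\<psi> $ j * cnj (v $ j))
      + (v $ i * cnj (v $ i)) * (v $ j * cnj (v $ j)))"
    by (intro sum.cong refl) (simp add: algebra_simps)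
  also have "\<dots> = 1 * 1 - ?z * cnj ?z - cnj ?z * ?z + 1 * 1"
    unfolding sum.distrib sum_subtractf sum_product [symmetric] cnj_sum [symmetric] one z ..
  also have "\<dots> = complex_of_real (2 - 2 * (cmod ?z)\<^sup>2)"
    by (simp add: complex_norm_square [symmetric] mult.commute [of "cnj _"] del: of_real_power)
  finally have total: "(\<Sum>i<n. \<Sum>j<n. (cmod (?d i j))\<^sup>2) = 2 - 2 * (cmod ?z)\<^sup>2"
    by (simp only: of_real_eq_iff)
  have "(cmod (?d i j))\<^sup>2 \<le> (\<Sum>j<n. (cmod (?d i j))\<^sup>2)"
    using ij by (intro member_le_sum) auto
  also have "\<dots> \<le> (\<Sum>i<n. \<Sum>j<n. (cmod (?d i j))\<^sup>2)"
    using ij by (intro member_le_sum [of i _ "\<lambda>i. \<Sum>j<n. (cmod (?d i j))\<^sup>2"]) (auto intro: sum_nonneg)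
  finally show ?thesis using c ij unfolding total by (simp add: ketbra_def)
qed

text \<open>If all product states missed the bound, so would their supremum. The slack e takes the
  place of a maximizer.\<close>

lemma nearby_product_state:
  assumes \<psi>: "pure_state (m * n) \<psi>" and mn: "0 < m" "0 < n" and e: "0 < e"
  obtains a b where "pure_state m a" "pure_state n b"
    "1 - pure_nonlocal_texture m n \<psi> - e < (cmod (\<psi> \<bullet>c tensor_vec a b))\<^sup>2"
proof (rule ccontr)
  assume "\<not> thesis"
  with that have no: "(cmod (\<psi> \<bullet>c tensor_vec a b))\<^sup>2 \<le> 1 - pure_nonlocal_texture m n \<psi> - e"
    if "pure_state m a" "pure_state n b" for a b
    using that by (meson not_less)
  have "max_overlap (unvec m n \<psi>) \<le> 1 - pure_nonlocal_texture m n \<psi> - e"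
  proof (rule max_overlap_least [OF unvec_carrier mn])
    fix x y assume x: "pure_state m x" and y: "pure_state n y"
    show "(cmod ((unvec m n \<psi> *\<^sub>v y) \<bullet>c x))\<^sup>2 \<le> 1 - pure_nonlocal_texture m n \<psi> - e"
      using no [OF x pure_state_conjugate [OF y]] unvec_overlap [of x m "conjugate y" n \<psi>] x y
      by (simp add: pure_state_def)
  qed
  moreover have "pure_nonlocal_texture m n \<psi> = 1 - max_overlap (unvec m n \<psi>)"
    using \<psi> mn by (intro pure_nonlocal_texture_eq) (auto simp: pure_state_def)
  ultimately show False using e by simp
qed

text \<open>Replacing each vector of a decomposition of small cost by a nearby product vector moves the
  entries of the matrix little; the square root in the estimate for one vector is removed by
  \<open>x \<le> (e + x\<^sup>2 / e) / 2\<close>.\<close>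

lemma product_ensemble_approx:
  assumes E: "pure_decomposition (m * n) \<rho> E" and mn: "0 < m" "0 < n" and e: "0 < e"
    and cost: "(\<Sum>(p, \<psi>)\<leftarrow>E. p * pure_nonlocal_texture m n \<psi>) < e\<^sup>2 / 8"
  shows "\<exists>E'. product_ensemble m n E' \<and>
    (\<forall>i<m * n. \<forall>j<m * n. cmod (\<rho> $$ (i, j) - ensemble_entry E' i j) < e)"
proof -
  let ?T = "pure_nonlocal_texture m n"
  have E1: "0 \<le> p" "pure_state (m * n) \<psi>" if "(p, \<psi>) \<in> set E" for p \<psi>
    using E that by (auto simp: pure_decomposition_def)
  have psum: "(\<Sum>(p, \<psi>)\<leftarrow>E. p) = 1" using E by (simp add: pure_decomposition_def)
  have "\<exists>ab. pure_state m (fst ab) \<and> pure_state n (snd ab) \<and>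
      1 - ?T \<psi> - e\<^sup>2 / 8 < (cmod (\<psi> \<bullet>c tensor_vec (fst ab) (snd ab)))\<^sup>2"
    if \<psi>: "pure_state (m * n) \<psi>" for \<psi>
  proof -
    have "0 < e\<^sup>2 / 8" using e by simp
    from nearby_product_state [OF \<psi> mn this] obtain a b where "pure_state m a" "pure_state n b"
      "1 - ?T \<psi> - e\<^sup>2 / 8 < (cmod (\<psi> \<bullet>c tensor_vec a b))\<^sup>2" .
    then show ?thesis by (intro exI [of _ "(a, b)"]) simp
  qed
  then obtain g where g: "\<And>\<psi>. pure_state (m * n) \<psi> \<Longrightarrow> pure_state m (fst (g \<psi>)) \<and> pure_state n (snd (g \<psi>)) \<and>
      1 - ?T \<psi> - e\<^sup>2 / 8 < (cmod (\<psi> \<bullet>c tensor_vec (fst (g \<psi>)) (snd (g \<psi>))))\<^sup>2"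
    by metis
  let ?v = "\<lambda>\<psi>. tensor_vec (fst (g \<psi>)) (snd (g \<psi>))"
  define E' where "E' = map (\<lambda>(p, \<psi>). (p, g \<psi>)) E"
  have "(\<Sum>(p, a, b)\<leftarrow>E'. p) = (\<Sum>(p, \<psi>)\<leftarrow>E. p)"
    by (simp add: E'_def o_def split_def)
  then have E': "product_ensemble m n E'"
    using E1 g psum by (auto simp: product_ensemble_def E'_def prod_eq_iff)
  have "cmod (\<rho> $$ (i, j) - ensemble_entry E' i j) < e" if ij: "i < m * n" "j < m * n" for i j
  proof -
    let ?x = "\<lambda>\<psi>. ketbra \<psi> $$ (i, j) - ketbra (?v \<psi>) $$ (i, j)"
    have kc: "set [complex_of_real p \<cdot>\<^sub>m ketbra \<psi>. (p, \<psi>) \<leftarrow> E] \<subseteq> carrier_mat (m * n) (m * n)"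
      using E1(2) by (auto simp: pure_state_def intro!: smult_carrier_mat ketbra_carrier)
    have "\<rho> $$ (i, j) = (\<Sum>M\<leftarrow>[complex_of_real p \<cdot>\<^sub>m ketbra \<psi>. (p, \<psi>) \<leftarrow> E]. M $$ (i, j))"
      using E mat_sum_index [OF kc ij] by (simp add: pure_decomposition_def)
    also have "\<dots> = (\<Sum>(p, \<psi>)\<leftarrow>E. complex_of_real p * ketbra \<psi> $$ (i, j))"
      unfolding map_map
    proof (intro arg_cong [of _ _ sum_list] map_cong refl)
      fix e assume "e \<in> set E"
      moreover obtain p \<psi> where e: "e = (p, \<psi>)" by (cases e)
      ultimately have "\<psi> \<in> carrier_vec (m * n)" using E1(2) by (auto simp: pure_state_def)
      then show "((\<lambda>M. M $$ (i, j)) \<circ> (\<lambda>(p, \<psi>). complex_of_real p \<cdot>\<^sub>m ketbra \<psi>)) e =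
          (case e of (p, \<psi>) \<Rightarrow> complex_of_real p * ketbra \<psi> $$ (i, j))"
        using ij by (simp add: e ketbra_def)
    qed
    finally have "\<rho> $$ (i, j) - ensemble_entry E' i j = (\<Sum>(p, \<psi>)\<leftarrow>E. complex_of_real p * ?x \<psi>)"
      by (simp add: ensemble_entry_def E'_def o_def split_def sum_list_subtractf [symmetric] right_diff_distrib)
    then have "cmod (\<rho> $$ (i, j) - ensemble_entry E' i j) \<le> (\<Sum>(p, \<psi>)\<leftarrow>E. cmod (complex_of_real p * ?x \<psi>))"
      using norm_sum_list_le [of "\<lambda>(p, \<psi>). complex_of_real p * ?x \<psi>" E] by (simp add: split_def)
    also have "\<dots> \<le> (\<Sum>(p, \<psi>)\<leftarrow>E. p * (5 / 8 * e) + p * ?T \<psi> / e)"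
    proof (rule sum_list_mono, clarify)
      fix p \<psi> assume p: "(p, \<psi>) \<in> set E"
      have pv: "pure_state (m * n) (?v \<psi>)" using g E1(2) [OF p] by (intro pure_state_tensor_vec) auto
      have "(cmod (?x \<psi>))\<^sup>2 \<le> 2 - 2 * (cmod (\<psi> \<bullet>c ?v \<psi>))\<^sup>2"
        by (rule ketbra_entry_diff [OF E1(2) [OF p] pv ij])
      also have "\<dots> \<le> 2 * (?T \<psi> + e\<^sup>2 / 8)" using g [OF E1(2) [OF p]] by simp
      finally have x2: "(cmod (?x \<psi>))\<^sup>2 \<le> 2 * (?T \<psi> + e\<^sup>2 / 8)" .
      have "2 * e * cmod (?x \<psi>) \<le> e\<^sup>2 + (cmod (?x \<psi>))\<^sup>2"
        using sum_squares_bound [of e "cmod (?x \<psi>)"] by simp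
      with x2 have "2 * e * cmod (?x \<psi>) \<le> e\<^sup>2 + 2 * (?T \<psi> + e\<^sup>2 / 8)" by simp
      \<comment> \<open>After division by 2 e, the term e^2 leaves e / 2 and the slack 2 e^2 / 8
        leaves e / 8; together they give 5 / 8.\<close>
      then have "cmod (?x \<psi>) \<le> 5 / 8 * e + ?T \<psi> / e"
        using e by (simp add: field_simps power2_eq_square)
      then have "p * cmod (?x \<psi>) \<le> p * (5 / 8 * e + ?T \<psi> / e)"
        using E1(1) [OF p] by (intro mult_left_mono)
      then show "cmod (complex_of_real p * ?x \<psi>) \<le> p * (5 / 8 * e) + p * ?T \<psi> / e"
        using E1(1) [OF p] by (simp add: norm_mult distrib_left)
    qed
    also have "\<dots> = (\<Sum>(p, \<psi>)\<leftarrow>E. p) * (5 / 8 * e) + (\<Sum>(p, \<psi>)\<leftarrow>E. p * ?T \<psi>) / e"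
      by (induction E) (auto simp: distrib_right add_divide_distrib)
    \<comment> \<open>The average cost is below e^2 / 8, so the total stays below 3 e / 4.\<close>
    also have "\<dots> < 5 / 8 * e + e\<^sup>2 / 8 / e"
      unfolding psum using divide_strict_right_mono [OF cost e] by linarith
    also have "\<dots> \<le> e" using e by (simp add: power2_eq_square)
    finally show ?thesis .
  qed
  with E' show ?thesis by blast
qed

subsection \<open>The non-local texture is an entanglement monotone\<close>

theorem corollary4:
  fixes dA dB :: nat
  shows "(\<forall>\<rho>. density_mat (dA * dB) \<rho> \<longrightarrow>
            nonlocal_texture dA dB \<rho> \<ge> 0 \<and>
            (nonlocal_texture dA dB \<rho> = 0 \<longleftrightarrow> separable_state dA dB \<rho>)) \<and>
         (\<forall>\<rho> \<Lambda>. density_mat (dA * dB) \<rho> \<longrightarrow> locc dA dB dA dB \<Lambda> \<longrightarrow>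
            nonlocal_texture dA dB (\<Lambda> \<rho>) \<le> nonlocal_texture dA dB \<rho>)"
proof -
  \<comment> \<open>In dimension zero the trace is an empty sum and cannot be 1.\<close>
  have pos: "0 < dA" "0 < dB" if "density_mat (dA * dB) \<rho>" for \<rho>
    using that by (auto simp: density_mat_def intro: ccontr)
  \<comment> \<open>A lower bound on all costs bounds the infimum because a density matrix has at
    least one decomposition.\<close>
  have lower: "C \<le> nonlocal_texture dA dB \<rho>"
    if \<rho>: "density_mat (dA * dB) \<rho>"
      and C: "\<And>F. vector_decomposition (dA * dB) \<rho> F \<Longrightarrow> C \<le> (\<Sum>\<phi>\<leftarrow>F. vector_cost dA dB \<phi>)" for C \<rho>
    unfolding nonlocal_texture_eq [OF pos [OF \<rho>]]
    using density_mat_vector_decomposition [OF \<rho>] C by (intro cINF_greatest) auto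
  have nonneg: "0 \<le> nonlocal_texture dA dB \<rho>" if "density_mat (dA * dB) \<rho>" for \<rho>
    using lower [OF that] vector_costs_nonneg [OF _ pos [OF that]] by blast
  have sep: "nonlocal_texture dA dB \<rho> = 0"
    if \<rho>: "density_mat (dA * dB) \<rho>" and s: "separable_state dA dB \<rho>" for \<rho>
  proof -
    note mn = pos [OF \<rho>]
    obtain E where E: "product_ensemble dA dB E"
      and \<rho>E: "\<rho> = mat_sum (dA * dB) (dA * dB)
        [complex_of_real p \<cdot>\<^sub>m tensor_mat (ketbra a) (ketbra b). (p, a, b) \<leftarrow> E]"
      using s unfolding separable_state_def product_ensemble_def by blast
    have pure: "0 \<le> p" "pure_state dA a" "pure_state dB b" if "(p, a, b) \<in> set E" for p a b
      using E that by (auto simp: product_ensemble_def)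
    define G where "G = map (\<lambda>(p, a, b). (p, tensor_vec a b)) E"
    have kb: "[complex_of_real p \<cdot>\<^sub>m tensor_mat (ketbra a) (ketbra b). (p, a, b) \<leftarrow> E] =
        [complex_of_real p \<cdot>\<^sub>m ketbra \<psi>. (p, \<psi>) \<leftarrow> G]"
      unfolding G_def map_map using pure
      by (intro map_cong refl) (auto simp: pure_state_def tensor_mat_ketbra [of _ dA _ dB])
    have "(\<Sum>(p, \<psi>)\<leftarrow>G. p) = (\<Sum>(p, a, b)\<leftarrow>E. p)"
      by (simp add: G_def o_def split_def)
    then have "(\<Sum>(p, \<psi>)\<leftarrow>G. p) = 1" using E by (simp add: product_ensemble_def)
    moreover have "\<forall>(p, \<psi>) \<in> set G. 0 \<le> p \<and> pure_state (dA * dB) \<psi>"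
      using pure by (auto simp: G_def intro!: pure_state_tensor_vec)
    ultimately have G: "pure_decomposition (dA * dB) \<rho> G"
      using \<rho>E unfolding pure_decomposition_def kb by blast
    \<comment> \<open>The overlap of the product vector with itself is 1 and takes part in the
      supremum.\<close>
    have zero: "pure_nonlocal_texture dA dB (tensor_vec a b) \<le> 0"
      if a: "pure_state dA a" and b: "pure_state dB b" for a b
    proof -
      have t: "pure_state (dA * dB) (tensor_vec a b)" using a b by (rule pure_state_tensor_vec)
      have "1 \<le> max_overlap (unvec dA dB (tensor_vec a b))"
        using max_overlap_upper [OF unvec_carrier a pure_state_conjugate [OF b], of "tensor_vec a b"]
          unvec_overlap [of a dA b dB "tensor_vec a b"] a b t by (simp add: pure_state_def)
      then show ?thesis using t mn by (simp add: pure_nonlocal_texture_eq pure_state_def)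
    qed
    from pure_decomposition_to_vectors [OF G mn] obtain F where
      F: "vector_decomposition (dA * dB) \<rho> F"
        "(\<Sum>\<phi>\<leftarrow>F. vector_cost dA dB \<phi>) = (\<Sum>(p, \<psi>)\<leftarrow>G. p * pure_nonlocal_texture dA dB \<psi>)" .
    have "nonlocal_texture dA dB \<rho> \<le> (\<Sum>(p, \<psi>)\<leftarrow>G. p * pure_nonlocal_texture dA dB \<psi>)"
      using nonlocal_texture_le [OF F(1) mn] F(2) by simp
    also have "\<dots> \<le> (\<Sum>(p, \<psi>)\<leftarrow>G. 0)"
      using pure zero by (intro sum_list_mono) (auto simp: G_def intro: mult_nonneg_nonpos)
    finally show ?thesis using nonneg [OF \<rho>] by (simp add: split_def)
  qed
  have zero: "separable_state dA dB \<rho>"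
    if \<rho>: "density_mat (dA * dB) \<rho>" and T: "nonlocal_texture dA dB \<rho> = 0" for \<rho>
  proof (rule separable_state_limit)
    show "\<rho> \<in> carrier_mat (dA * dB) (dA * dB)" using \<rho> by (simp add: density_mat_def)
    fix e :: real assume e: "0 < e"
    obtain F where "vector_decomposition (dA * dB) \<rho> F"
      using density_mat_vector_decomposition [OF \<rho>] .
    from vectors_to_pure_decomposition [OF this pos [OF \<rho>]]
    have "{E. pure_decomposition (dA * dB) \<rho> E} \<noteq> {}" by blast
    \<comment> \<open>An infimum 0 is approached but perhaps not visibly attained, so a
      decomposition of cost below the threshold of the approximation lemma is chosen for each
      e.\<close>
    moreover have "nonlocal_texture dA dB \<rho> < e\<^sup>2 / 8" using e T by simp
    ultimately have "\<exists>t \<in> (\<lambda>E. \<Sum>(p, \<psi>)\<leftarrow>E. p * pure_nonlocal_texture dA dB \<psi>) `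
        {E. pure_decomposition (dA * dB) \<rho> E}. t < e\<^sup>2 / 8"
      unfolding nonlocal_texture_def by (intro cInf_lessD) auto
    then obtain E where "pure_decomposition (dA * dB) \<rho> E"
      "(\<Sum>(p, \<psi>)\<leftarrow>E. p * pure_nonlocal_texture dA dB \<psi>) < e\<^sup>2 / 8"
      by blast
    then show "\<exists>E. product_ensemble dA dB E \<and>
        (\<forall>i<dA * dB. \<forall>j<dA * dB. cmod (\<rho> $$ (i, j) - ensemble_entry E i j) < e)"
      by (rule product_ensemble_approx [OF _ pos [OF \<rho>] e])
  qed
  have mono: "nonlocal_texture dA dB (\<Lambda> \<rho>) \<le> nonlocal_texture dA dB \<rho>"
    if \<rho>: "density_mat (dA * dB) \<rho>" and \<Lambda>: "locc dA dB dA dB \<Lambda>" for \<rho> \<Lambda>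
  \<comment> \<open>Each decomposition of \<rho> is compared with its image, which is a
    decomposition of \<Lambda> \<rho> and bounds the texture there from above.\<close>
  proof (rule lower [OF \<rho>])
    fix F assume "vector_decomposition (dA * dB) \<rho> F"
    from locc_vector_decomposition [OF \<Lambda> pos [OF \<rho>] this]
    obtain F' where "vector_decomposition (dA * dB) (\<Lambda> \<rho>) F'"
      "(\<Sum>\<phi>\<leftarrow>F'. vector_cost dA dB \<phi>) \<le> (\<Sum>\<phi>\<leftarrow>F. vector_cost dA dB \<phi>)" by blast
    then show "nonlocal_texture dA dB (\<Lambda> \<rho>) \<le> (\<Sum>\<phi>\<leftarrow>F. vector_cost dA dB \<phi>)"
      using nonlocal_texture_le [OF _ pos [OF \<rho>]] by (meson order_trans)
  qed
  show ?thesis using nonneg sep zero mono by blast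
qed

end
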